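(* The subset $\mathbb{Y}_{triv}$ of $\mathbb{Y}$ consisting of (isomorphism classes of) metric measure spaces $(X,d,\mu)$ with full coherent algebra, i.e. with $\mathrm{Coh}(X)=C(X\times X)$, is residual in $\mathbb{Y}$.
   Context: **Metric measure spaces.** A metric measure space is a triple $(X,d,\mu)$ where $(X,d)$ is a compact metric space and $\mu$ is a faithful (i.e. full support) Borel probability measure on $X$. Isomorphisms are measure-preserving surjective isometries. $\mathbb{Y}$ is the collection of isomorphism classes. **Topology on $\mathbb{Y}$.** For $\varepsilon>0$, an $\varepsilon$-isometry $f:X\to Y$ between metric spaces $(X,d_X)$ and $(Y,d_Y)$ is a possibly discontinuous function such that the $\varepsilon$-neighborhood of $f(X)$ is all of $Y$ and $|d_Y(f(x),f(x'))-d_X(x,x')|\le\varepsilon$ for all $x,x'\in X$. For $p\ge 1$ and probability measures $\mu,\nu$ on a compact metric space $(Y,d_Y)$, the Wasserstein distance is $$W_p(\mu,\nu)=\inf_\pi\left(\int_{Y\times Y}d_Y(y,y')^p\,\mathrm{d}\pi(y,y')\right)^{1/p},$$ $\pi$ ranging over probability measures on $Y\times Y$ with marginals $\mu$ and $\nu$. For $(X,d_X,\mu_X),(Y,d_Y,\mu_Y)\in\mathbb{Y}$, $D_p(X,Y)$ is the infimum of those $t>0$ for which there is a measurable $t$-isometry $f:X\to Y$ with $W_p(f_*\mu_X,\mu_Y)\le t$. The topology on $\mathbb{Y}$ is the one in which the neighborhoods of $X\in\mathbb{Y}$ are the sets containing $\{Y\in\mathbb{Y}\mid D_p(X,Y)<\varepsilon\}$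 for some $\varepsilon>0$; the choice of $p\ge1$ makes no difference. **Residual.** A subset of $\mathbb{Y}$ is residual if it contains a dense $G_\delta$. **Coherent algebra.** For a metric measure space $(X,d,\mu)$, convolution on $C(X\times X)$ is $$(f*g)(x,z)=\int_X f(x,y)g(y,z)\,\mathrm{d}\mu(y).$$ The coherent algebra $\mathrm{Coh}(X)$ is the smallest unital $C^*$-subalgebra of $C(X\times X)$ (with respect to the standard pointwise algebra structure) that contains $d$, is closed under the convolution $*$, and is closed under flips: if $f\in\mathrm{Coh}(X)$ then so is $(x,y)\mapsto f(y,x)$. *)

theory Defs
  imports "HOL-Probability.Probability"
begin

section \<open>Metric measure spaces\<close>

definition borel_of :: "'a topology \<Rightarrow> 'a measure" where
  "borel_of T = sigma (topspace T) {U. openin T U}"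

definition mm_space :: "'a metric \<Rightarrow> 'a measure \<Rightarrow> bool" where
  "mm_space X \<mu> \<longleftrightarrow>
     compact_space (mtopology_of X) \<and>
     prob_space \<mu> \<and> sets \<mu> = sets (borel_of (mtopology_of X)) \<and>
     (\<forall>U. openin (mtopology_of X) U \<and> U \<noteq> {} \<longrightarrow> 0 < emeasure \<mu> U)"

definition mm_iso :: "'a metric \<Rightarrow> 'a measure \<Rightarrow> 'b metric \<Rightarrow> 'b measure \<Rightarrow> bool" where
  "mm_iso X \<mu> Y \<nu> \<longleftrightarrow>
     (\<exists>f. f ` mspace X = mspace Y \<and>
          (\<forall>x\<in>mspace X. \<forall>x'\<in>mspace X. mdist Y (f x) (f x') = mdist X x x') \<and>
          f \<in> measurable \<mu> \<nu> \<and> distr \<mu> \<nu> f = \<nu>)"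

text \<open>
  Isomorphism classes range over all compact metric spaces, which HOL cannot collect in one
  set.  A compact metric space has at most continuum many points, so it is enough to take
  spaces whose points are real numbers (with an arbitrary metric unrelated to that of the
  reals); the lemma \<open>mm_space_real_model\<close> shows that every metric measure
  space, over any type, is isomorphic to one of these.
\<close>

lemma mm_space_lepoll_real:
  assumes "mm_space X \<mu>"
  shows "mspace X \<lesssim> (UNIV :: real set)"
proof -
  interpret X: Metric_space "mspace X" "mdist X" by simp
  have "compactin X.mtopology (mspace X)"
    using assms by (simp add: mm_space_def compact_space_def mtopology_of_def)
  then have tb: "X.mtotally_bounded (mspace X)"
    by (rule X.compactin_imp_mtotally_bounded)
  then have "\<forall>k::nat. \<exists>K. finite K \<and> K \<subseteq> mspace X \<and>
               mspace X \<subseteq> (\<Union>x\<in>K. X.mball x (1 / (real k + 1)))"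
    unfolding X.mtotally_bounded_def by (simp add: add_pos_nonneg)
  then obtain K where K: "\<And>k. finite (K k)" "\<And>k. K k \<subseteq> mspace X"
      "\<And>k::nat. mspace X \<subseteq> (\<Union>x\<in>K k. X.mball x (1 / (real k + 1)))"
    by metis
  define C where "C = (\<Union>k. K k)"
  have "countable C"
    unfolding C_def using K(1) by (simp add: countable_finite)
  define h where
    "h x = {prod_encode (to_nat_on C c, k) | c k. c \<in> C \<and> mdist X c x < 1 / (real k + 1)}" for x
  have "inj_on h (mspace X)"
  proof (rule inj_onI, rule ccontr)
    fix x y assume xy: "x \<in> mspace X" "y \<in> mspace X" "h x = h y" "x \<noteq> y"
    then have "0 < mdist X x y / 2" by (simp add: order_less_le)
    then obtain k :: nat where k: "1 / (real k + 1) < mdist X x y / 2"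
      by (metis nat_approx_posE add.commute of_nat_Suc)
    obtain c where c: "c \<in> K k" "mdist X c x < 1 / (real k + 1)"
      using K(3)[of k] xy(1) by (auto simp: X.in_mball)
    have cC: "c \<in> C" and cX: "c \<in> mspace X" using c(1) K(2) by (auto simp: C_def)
    have "prod_encode (to_nat_on C c, k) \<in> h y"
      using cC c(2) unfolding xy(3)[symmetric] by (auto simp: h_def)
    then obtain c' k' where c': "prod_encode (to_nat_on C c, k) = prod_encode (to_nat_on C c', k')"
        "c' \<in> C" "mdist X c' y < 1 / (real k' + 1)"
      by (auto simp: h_def)
    then have "to_nat_on C c = to_nat_on C c'" "k' = k" by simp_all
    with c' cC \<open>countable C\<close> have "mdist X c y < 1 / (real k + 1)"
      by (metis to_nat_on_inj)
    moreover have "mdist X x y \<le> mdist X c x + mdist X c y"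
      using mdist_triangle[of x X c y] mdist_commute[of X x c] xy cX by simp
    ultimately show False using c(2) k by linarith
  qed
  then have "mspace X \<lesssim> (UNIV :: nat set set)"
    unfolding lepoll_def by blast
  also have "(UNIV :: nat set set) \<approx> (UNIV :: real set)"
    by (rule nat_sets_eqpoll_reals)
  finally show ?thesis .
qed

lemma mm_space_real_model:
  assumes "mm_space X \<mu>"
  shows "\<exists>(Y :: real metric) \<nu>. mm_space Y \<nu> \<and> mm_iso X \<mu> Y \<nu>"
proof -
  obtain h :: "'a \<Rightarrow> real" where h: "inj_on h (mspace X)"
    using mm_space_lepoll_real[OF assms] by (auto simp: lepoll_def)
  define g where "g = the_inv_into (mspace X) h"
  have gh: "g (h x) = x" if "x \<in> mspace X" for x
    using h that by (simp add: g_def the_inv_into_f_f)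
  interpret X: Metric_space "mspace X" "mdist X" by simp
  let ?d = "\<lambda>y y'. mdist X (g y) (g y')"
  interpret Y: Metric_space "h ` mspace X" ?d
    by unfold_locales (auto simp: gh mdist_commute mdist_triangle)
  define Y where "Y = metric (h ` mspace X, ?d)"
  have mY: "mspace Y = h ` mspace X" "mdist Y = ?d"
    by (simp_all add: Y_def)
  have tY: "mtopology_of Y = Y.mtopology" by (simp add: Y_def)
  have tX: "mtopology_of X = X.mtopology" by (simp add: mtopology_of_def)
  interpret XY: Metric_space12 "mspace X" "mdist X" "h ` mspace X" ?d ..
  have hom: "homeomorphic_map (mtopology_of X) (mtopology_of Y) h"
    unfolding tY tX
    by (rule XY.isometry_imp_homeomorphic_map) (auto simp: gh)
  define \<nu> where "\<nu> = distr \<mu> (borel_of (mtopology_of Y)) h"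
  have sets_bo: "sets (borel_of T) = sigma_sets (topspace T) {U. openin T U}"
    and space_bo: "space (borel_of T) = topspace T" for T :: "'c topology"
    unfolding borel_of_def using openin_subset by (fastforce intro!: sets_measure_of space_measure_of)+
  have P: "prob_space \<mu>" and S: "sets \<mu> = sets (borel_of (mtopology_of X))"
    and C: "compact_space (mtopology_of X)"
    and F: "\<And>U. openin (mtopology_of X) U \<Longrightarrow> U \<noteq> {} \<Longrightarrow> 0 < emeasure \<mu> U"
    using assms by (auto simp: mm_space_def)
  have sp: "space \<mu> = mspace X"
    using sets_eq_imp_space_eq[OF S] by (simp add: space_bo)
  have pre: "openin (mtopology_of X) (h -` U \<inter> mspace X)" if "openin (mtopology_of Y) U" for U
  proof -
    have "continuous_map (mtopology_of X) (mtopology_of Y) h"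
      using hom homeomorphic_imp_continuous_map by blast
    from openin_continuous_map_preimage[OF this that] show ?thesis
      by (simp add: vimage_def Int_def conj_commute)
  qed
  have hm: "h \<in> measurable \<mu> (borel_of (mtopology_of Y))"
    unfolding borel_of_def
  proof (rule measurable_measure_of)
    show "{U. openin (mtopology_of Y) U} \<subseteq> Pow (topspace (mtopology_of Y))"
      using openin_subset by fastforce
    show "h \<in> space \<mu> \<rightarrow> topspace (mtopology_of Y)" by (auto simp: sp mY)
    show "h -` U \<inter> space \<mu> \<in> sets \<mu>" if "U \<in> {U. openin (mtopology_of Y) U}" for U
      using pre[of U] that unfolding S sets_bo sp by auto
  qed
  have "mm_space Y \<nu>"
    unfolding mm_space_def
  proof (intro conjI allI impI)
    show "compact_space (mtopology_of Y)"
      using C hom homeomorphic_compact_space homeomorphic_map_imp_homeomorphic_space by blast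
    show "prob_space \<nu>"
      unfolding \<nu>_def using hm P by (simp add: prob_space.prob_space_distr)
    show "sets \<nu> = sets (borel_of (mtopology_of Y))" by (simp add: \<nu>_def)
    fix U assume U: "openin (mtopology_of Y) U \<and> U \<noteq> {}"
    have "U \<in> sets (borel_of (mtopology_of Y))" using U by (auto simp: sets_bo)
    then have "emeasure \<nu> U = emeasure \<mu> (h -` U \<inter> mspace X)"
      unfolding \<nu>_def using hm by (simp add: emeasure_distr sp)
    moreover have "U \<subseteq> h ` mspace X" using U openin_subset[of "mtopology_of Y" U] by (simp add: mY)
    then have "h -` U \<inter> mspace X \<noteq> {}" using U by blast
    ultimately show "0 < emeasure \<nu> U" using F pre U by simp
  qed
  moreover have "mm_iso X \<mu> Y \<nu>"
    unfolding mm_iso_def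
  proof (intro exI[of _ h] conjI)
    show "h ` mspace X = mspace Y" by (simp add: mY)
    show "\<forall>x\<in>mspace X. \<forall>x'\<in>mspace X. mdist Y (h x) (h x') = mdist X x x'"
      by (simp add: mY gh)
    have eq: "sets \<nu> = sets (borel_of (mtopology_of Y))" by (simp add: \<nu>_def)
    show "h \<in> measurable \<mu> \<nu>" using hm measurable_cong_sets[OF refl eq] by blast
    have "distr \<mu> \<nu> h = distr \<mu> (borel_of (mtopology_of Y)) h"
      by (rule distr_cong) (simp_all add: eq)
    then show "distr \<mu> \<nu> h = \<nu>" by (simp add: \<nu>_def)
  qed
  ultimately show ?thesis by blast
qed

definition mm_class ::
    "real metric \<Rightarrow> real measure \<Rightarrow> (real metric \<times> real measure) set" where
  "mm_class X \<mu> = {(Y, \<nu>). mm_space Y \<nu> \<and> mm_iso X \<mu> Y \<nu>}"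

definition mm_classes :: "(real metric \<times> real measure) set set" where
  "mm_classes = {mm_class X \<mu> | X \<mu>. mm_space X \<mu>}"


section \<open>The topology\<close>

definition eps_isometry :: "real \<Rightarrow> 'a metric \<Rightarrow> 'b metric \<Rightarrow> ('a \<Rightarrow> 'b) \<Rightarrow> bool" where
  "eps_isometry e X Y f \<longleftrightarrow>
     f \<in> mspace X \<rightarrow> mspace Y \<and>
     (\<forall>y\<in>mspace Y. \<exists>x\<in>mspace X. mdist Y (f x) y < e) \<and>
     (\<forall>x\<in>mspace X. \<forall>x'\<in>mspace X. \<bar>mdist Y (f x) (f x') - mdist X x x'\<bar> \<le> e)"

text \<open>
  On the second countable spaces considered here the product \<open>\<sigma>\<close>-algebra is the
  Borel \<open>\<sigma>\<close>-algebra of the product topology.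
\<close>

definition couplings :: "'a measure \<Rightarrow> 'b measure \<Rightarrow> ('a \<times> 'b) measure set" where
  "couplings \<mu> \<nu> =
     {\<pi>. prob_space \<pi> \<and> sets \<pi> = sets (\<mu> \<Otimes>\<^sub>M \<nu>) \<and>
         distr \<pi> \<mu> fst = \<mu> \<and> distr \<pi> \<nu> snd = \<nu>}"

definition wasserstein :: "real \<Rightarrow> 'a metric \<Rightarrow> 'a measure \<Rightarrow> 'a measure \<Rightarrow> real" where
  "wasserstein p Y \<mu> \<nu> =
     (INF \<pi>\<in>couplings \<mu> \<nu>. (\<integral>z. mdist Y (fst z) (snd z) powr p \<partial>\<pi>) powr (1 / p))"

definition mm_dist ::
    "real \<Rightarrow> 'a metric \<Rightarrow> 'a measure \<Rightarrow> 'b metric \<Rightarrow> 'b measure \<Rightarrow> real" where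
  "mm_dist p X \<mu> Y \<nu> =
     Inf {t. 0 < t \<and>
             (\<exists>f. f \<in> measurable \<mu> \<nu> \<and> eps_isometry t X Y f \<and>
                  wasserstein p Y (distr \<mu> \<nu> f) \<nu> \<le> t)}"

text \<open>
  A set of classes is open iff it contains, with each of its points, a \<open>D\<^sub>p\<close>-ball around
  that point; \<open>D\<^sub>p\<close> is evaluated on representatives.  A topology with the prescribed
  neighborhoods has exactly these open sets.
\<close>

definition mm_open :: "real \<Rightarrow> (real metric \<times> real measure) set set \<Rightarrow> bool" where
  "mm_open p \<U> \<longleftrightarrow>
     \<U> \<subseteq> mm_classes \<and>
     (\<forall>X \<mu>. mm_space X \<mu> \<and> mm_class X \<mu> \<in> \<U> \<longrightarrow>
        (\<exists>\<epsilon>>0. \<forall>Y \<nu>. mm_space Y \<nu> \<and> mm_dist p X \<mu> Y \<nu> < \<epsilon> \<longrightarrow> mm_class Y \<nu> \<in> \<U>))"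

definition mm_topology :: "real \<Rightarrow> (real metric \<times> real measure) set topology" where
  "mm_topology p = topology (mm_open p)"

lemma istopology_mm_open: "istopology (mm_open p)"
  unfolding istopology_def
proof (intro conjI allI impI)
  fix \<U> \<V> assume UV: "mm_open p \<U>" "mm_open p \<V>"
  show "mm_open p (\<U> \<inter> \<V>)"
    unfolding mm_open_def
  proof (intro conjI allI impI)
    show "\<U> \<inter> \<V> \<subseteq> mm_classes" using UV by (auto simp: mm_open_def)
    fix X \<mu> assume X: "mm_space X \<mu> \<and> mm_class X \<mu> \<in> \<U> \<inter> \<V>"
    obtain a where "a > 0"
        "\<And>Y \<nu>. mm_space Y \<nu> \<Longrightarrow> mm_dist p X \<mu> Y \<nu> < a \<Longrightarrow> mm_class Y \<nu> \<in> \<U>"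
      using UV(1) X unfolding mm_open_def by blast
    moreover obtain b where "b > 0"
        "\<And>Y \<nu>. mm_space Y \<nu> \<Longrightarrow> mm_dist p X \<mu> Y \<nu> < b \<Longrightarrow> mm_class Y \<nu> \<in> \<V>"
      using UV(2) X unfolding mm_open_def by blast
    ultimately show "\<exists>\<epsilon>>0. \<forall>Y \<nu>. mm_space Y \<nu> \<and> mm_dist p X \<mu> Y \<nu> < \<epsilon> \<longrightarrow>
        mm_class Y \<nu> \<in> \<U> \<inter> \<V>"
      by (intro exI[of _ "min a b"]) auto
  qed
next
  fix \<K> assume K: "\<forall>\<U>\<in>\<K>. mm_open p \<U>"
  show "mm_open p (\<Union>\<K>)"
    unfolding mm_open_def
  proof (intro conjI allI impI)
    show "\<Union>\<K> \<subseteq> mm_classes" using K by (auto simp: mm_open_def)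
    fix X \<mu> assume X: "mm_space X \<mu> \<and> mm_class X \<mu> \<in> \<Union>\<K>"
    then obtain \<U> where U: "\<U> \<in> \<K>" "mm_class X \<mu> \<in> \<U>" by blast
    then have "mm_open p \<U>" using K by blast
    with X U(2) obtain a where "a > 0"
        "\<And>Y \<nu>. mm_space Y \<nu> \<Longrightarrow> mm_dist p X \<mu> Y \<nu> < a \<Longrightarrow> mm_class Y \<nu> \<in> \<U>"
      unfolding mm_open_def by blast
    with U(1) show "\<exists>\<epsilon>>0. \<forall>Y \<nu>. mm_space Y \<nu> \<and> mm_dist p X \<mu> Y \<nu> < \<epsilon> \<longrightarrow>
        mm_class Y \<nu> \<in> \<Union>\<K>"
      by blast
  qed
qed

lemma openin_mm_topology: "openin (mm_topology p) \<U> \<longleftrightarrow> mm_open p \<U>"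
  by (simp add: mm_topology_def topology_inverse' istopology_mm_open)

lemma topspace_mm_topology: "topspace (mm_topology p) = mm_classes"
proof -
  have "mm_open p mm_classes"
    unfolding mm_open_def
  proof (intro conjI allI impI)
    show "\<exists>\<epsilon>>0. \<forall>Y \<nu>. mm_space Y \<nu> \<and> mm_dist p X \<mu> Y \<nu> < \<epsilon> \<longrightarrow> mm_class Y \<nu> \<in> mm_classes"
      for X \<mu>
      by (intro exI[of _ 1]) (auto simp: mm_classes_def)
  qed simp
  then show ?thesis
    unfolding topspace_def openin_mm_topology by (auto simp: mm_open_def)
qed

definition residual_in :: "'a topology \<Rightarrow> 'a set \<Rightarrow> bool" where
  "residual_in T S \<longleftrightarrow>
     S \<subseteq> topspace T \<and> (\<exists>G\<subseteq>S. gdelta_in T G \<and> T closure_of G = topspace T)"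


section \<open>The coherent algebra\<close>

text \<open>Functions in \<open>cfunspace\<close> are extensional, hence the restrictions below.\<close>

abbreviation C2 :: "'a metric \<Rightarrow> ('a \<times> 'a \<Rightarrow> complex) metric" where
  "C2 X \<equiv> cfunspace (prod_topology (mtopology_of X) (mtopology_of X)) euclidean_metric"

definition unital_cstar_subalgebra :: "'a metric \<Rightarrow> ('a \<times> 'a \<Rightarrow> complex) set \<Rightarrow> bool" where
  "unital_cstar_subalgebra X A \<longleftrightarrow>
     A \<subseteq> mspace (C2 X) \<and>
     closedin (mtopology_of (C2 X)) A \<and>
     (\<lambda>z\<in>mspace X \<times> mspace X. 1) \<in> A \<and>
     (\<forall>f\<in>A. \<forall>g\<in>A. (\<lambda>z\<in>mspace X \<times> mspace X. f z + g z) \<in> A) \<and>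
     (\<forall>f\<in>A. \<forall>g\<in>A. (\<lambda>z\<in>mspace X \<times> mspace X. f z * g z) \<in> A) \<and>
     (\<forall>c. \<forall>f\<in>A. (\<lambda>z\<in>mspace X \<times> mspace X. c * f z) \<in> A) \<and>
     (\<forall>f\<in>A. (\<lambda>z\<in>mspace X \<times> mspace X. cnj (f z)) \<in> A)"

definition convolution ::
    "'a metric \<Rightarrow> 'a measure \<Rightarrow> ('a \<times> 'a \<Rightarrow> complex) \<Rightarrow> ('a \<times> 'a \<Rightarrow> complex) \<Rightarrow> 'a \<times> 'a \<Rightarrow> complex" where
  "convolution X \<mu> f g =
     (\<lambda>z\<in>mspace X \<times> mspace X. \<integral>y. f (fst z, y) * g (y, snd z) \<partial>\<mu>)"

definition coherent_subalgebra ::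
    "'a metric \<Rightarrow> 'a measure \<Rightarrow> ('a \<times> 'a \<Rightarrow> complex) set \<Rightarrow> bool" where
  "coherent_subalgebra X \<mu> A \<longleftrightarrow>
     unital_cstar_subalgebra X A \<and>
     (\<lambda>z\<in>mspace X \<times> mspace X. complex_of_real (mdist X (fst z) (snd z))) \<in> A \<and>
     (\<forall>f\<in>A. \<forall>g\<in>A. convolution X \<mu> f g \<in> A) \<and>
     (\<forall>f\<in>A. (\<lambda>z\<in>mspace X \<times> mspace X. f (snd z, fst z)) \<in> A)"

definition Coh :: "'a metric \<Rightarrow> 'a measure \<Rightarrow> ('a \<times> 'a \<Rightarrow> complex) set" where
  "Coh X \<mu> = \<Inter>{A. coherent_subalgebra X \<mu> A}"

definition mm_triv :: "(real metric \<times> real measure) set set" where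
  "mm_triv = {mm_class X \<mu> | X \<mu>. mm_space X \<mu> \<and> Coh X \<mu> = mspace (C2 X)}"

end

theory Submission
  imports Defs
begin

text \<open>
  The convolution \<open>d * 1\<close> is the mean distance \<open>\<phi>(x) = \<integral> d(x,y) d\<mu>(y)\<close>, regarded as a function
  on \<open>X \<times> X\<close>.  If \<open>\<phi>\<close> is injective, then \<open>X\<close> is homeomorphic to a compact set of reals, and the
  polynomials in \<open>\<phi>(x)\<close> and \<open>\<phi>(z)\<close>, all of which lie in the coherent algebra, are dense in
  \<open>C(X \<times> X)\<close> by Stone--Weierstrass.  It remains to see that injectivity of \<open>\<phi>\<close> is generic.  The
  condition that \<open>\<phi>\<close> uniformly separates points at distance at least \<open>s\<close>, for some \<open>s < 1/n\<close>, is
  open, since an \<open>\<epsilon>\<close>-isometry that almost preserves the measure almost preserves \<open>\<phi>\<close>.  Injectivity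
  is dense: every space is close to a finite one, and on a finite space a small generic
  perturbation of the weights makes \<open>\<phi>\<close> injective.
\<close>

definition mean_dist :: "'a metric \<Rightarrow> 'a measure \<Rightarrow> 'a \<Rightarrow> real" where
  "mean_dist X \<mu> x = (\<integral>y. mdist X x y \<partial>\<mu>)"

section \<open>Measurability on metric measure spaces\<close>

lemma sets_borel_of: "sets (borel_of T) = sigma_sets (topspace T) {U. openin T U}"
  and space_borel_of: "space (borel_of T) = topspace T"
  unfolding borel_of_def using openin_subset
  by (fastforce intro!: sets_measure_of space_measure_of)+

lemma mm_spaceD:
  assumes "mm_space X \<mu>"
  shows "prob_space \<mu>" "compact_space (mtopology_of X)"
    "sets \<mu> = sets (borel_of (mtopology_of X))" "space \<mu> = mspace X" "mspace X \<noteq> {}"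
proof -
  show "prob_space \<mu>" "compact_space (mtopology_of X)"
    and S: "sets \<mu> = sets (borel_of (mtopology_of X))"
    using assms by (auto simp: mm_space_def)
  show "space \<mu> = mspace X"
    using sets_eq_imp_space_eq[OF S] by (simp add: space_borel_of)
  with prob_space.not_empty[OF \<open>prob_space \<mu>\<close>] show "mspace X \<noteq> {}" by simp
qed

lemma mm_space_compactin:
  assumes "mm_space X \<mu>"
  shows "compactin (Metric_space.mtopology (mspace X) (mdist X)) (mspace X)"
  using mm_spaceD(2)[OF assms]
  by (metis compact_space_def mtopology_of_def topspace_mtopology_of)

lemma openin_mm_sets:
  assumes "mm_space X \<mu>" "openin (mtopology_of X) U"
  shows "U \<in> sets \<mu>"
  using assms by (auto simp: mm_spaceD(3)[OF assms(1)] sets_borel_of)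

lemma continuous_map_measurable:
  assumes "mm_space X \<mu>" "continuous_map (mtopology_of X) euclidean g"
  shows "g \<in> borel_measurable \<mu>"
proof (rule borel_measurableI)
  fix U :: "'b set" assume "open U"
  then have "openin (mtopology_of X) (g -` U \<inter> space \<mu>)"
    using openin_continuous_map_preimage[OF assms(2), of U]
    by (simp add: mm_spaceD(4)[OF assms(1)] vimage_def Int_def conj_commute)
  then show "g -` U \<inter> space \<mu> \<in> sets \<mu>"
    using openin_mm_sets assms(1) by blast
qed

lemma mm_space_diameter:
  assumes "mm_space X \<mu>"
  obtains D where "D > 0" "\<And>x y. x \<in> mspace X \<Longrightarrow> y \<in> mspace X \<Longrightarrow> mdist X x y \<le> D"
proof -
  interpret X: Metric_space "mspace X" "mdist X" by simp
  have "X.mbounded (mspace X)"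
    by (rule X.compactin_imp_mbounded[OF mm_space_compactin[OF assms]])
  then show ?thesis
    using that unfolding X.mbounded_alt_pos by metis
qed

lemma mm_space_finite_net:
  assumes "mm_space X \<mu>" "e > 0"
  obtains K where "finite K" "K \<subseteq> mspace X" "K \<noteq> {}"
    "\<And>x. x \<in> mspace X \<Longrightarrow> \<exists>c\<in>K. mdist X c x < e"
proof -
  interpret X: Metric_space "mspace X" "mdist X" by simp
  have "X.mtotally_bounded (mspace X)"
    by (rule X.compactin_imp_mtotally_bounded[OF mm_space_compactin[OF assms(1)]])
  then obtain K where K: "finite K" "K \<subseteq> mspace X" "mspace X \<subseteq> (\<Union>x\<in>K. X.mball x e)"
    using assms(2) unfolding X.mtotally_bounded_def by metis
  moreover have "K \<noteq> {}" using K(3) mm_spaceD(5)[OF assms(1)] by auto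
  moreover have "\<exists>c\<in>K. mdist X c x < e" if "x \<in> mspace X" for x
    using K(3) that by fastforce
  ultimately show ?thesis using that by blast
qed

lemma measurable_mdist_const:
  assumes "mm_space X \<mu>" "c \<in> mspace X"
  shows "mdist X c \<in> borel_measurable \<mu>"
  by (intro continuous_map_measurable[OF assms(1)] continuous_on_mdist assms(2))

text \<open>The distance is a limit of minima over finite nets of functions \<open>d(x,c) + d(c,y)\<close>;
  this is where second countability enters.\<close>

lemma measurable_mdist:
  assumes "mm_space X \<mu>" "sets m = sets \<mu>" "sets \<nu> = sets \<mu>" "sets \<pi> = sets (m \<Otimes>\<^sub>M \<nu>)"
  shows "(\<lambda>z. mdist X (fst z) (snd z)) \<in> borel_measurable \<pi>"
proof -
  interpret X: Metric_space "mspace X" "mdist X" by simp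
  have "\<exists>K. finite K \<and> K \<subseteq> mspace X \<and> K \<noteq> {} \<and>
      (\<forall>x\<in>mspace X. \<exists>c\<in>K. mdist X c x < 1 / (real k + 1))" for k
  proof -
    have "0 < 1 / (real k + 1)" by (simp add: add_pos_nonneg)
    from mm_space_finite_net[OF assms(1) this] show ?thesis by metis
  qed
  then obtain K where K: "\<And>k. finite (K k)" "\<And>k. K k \<subseteq> mspace X" "\<And>k. K k \<noteq> {}"
      "\<And>k x. x \<in> mspace X \<Longrightarrow> \<exists>c\<in>K k. mdist X c x < 1 / (real k + 1)"
    by metis
  define g where "g k z = Min ((\<lambda>c. mdist X c (fst z) + mdist X c (snd z)) ` K k)" for k z
  have spm: "space m = mspace X" "space \<nu> = mspace X"
    using sets_eq_imp_space_eq[OF assms(2)] sets_eq_imp_space_eq[OF assms(3)]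
      mm_spaceD(4)[OF assms(1)] by auto
  have sp: "space \<pi> = mspace X \<times> mspace X"
    using sets_eq_imp_space_eq[OF assms(4)] by (simp add: space_pair_measure spm)
  have "g k \<in> borel_measurable (m \<Otimes>\<^sub>M \<nu>)" for k
  proof -
    have [measurable]: "mdist X c \<in> borel_measurable m" "mdist X c \<in> borel_measurable \<nu>"
      if "c \<in> K k" for c
      using measurable_mdist_const[OF assms(1), of c] that K(2)[of k]
        measurable_cong_sets[OF assms(2) refl, of borel]
        measurable_cong_sets[OF assms(3) refl, of borel] by auto
    show ?thesis
      unfolding g_def by (intro borel_measurable_Min K(1)) measurable
  qed
  then have gm: "g k \<in> borel_measurable \<pi>" for k
    using measurable_cong_sets[OF assms(4) refl] by blast
  show ?thesis
  proof (rule borel_measurable_LIMSEQ_real[OF _ gm])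
    fix z assume "z \<in> space \<pi>"
    then obtain x y where z: "z = (x, y)" "x \<in> mspace X" "y \<in> mspace X" by (auto simp: sp)
    have lo: "mdist X x y \<le> g k z" for k
    proof -
      have "mdist X x y \<le> mdist X c x + mdist X c y" if "c \<in> K k" for c
        using X.triangle[of x c y] X.commute[of x c] that K(2)[of k] z by auto
      then show ?thesis unfolding g_def using K(1)[of k] K(3)[of k] z by auto
    qed
    \<comment> \<open>A net point within \<open>1 / (real k + 1)\<close> of \<open>x\<close> makes
      the detour exceed the distance by at most twice that radius.\<close>
    have hi: "g k z \<le> mdist X x y + 2 * (1 / (real k + 1))" for k
    proof -
      obtain c where c: "c \<in> K k" "mdist X c x < 1 / (real k + 1)" using K(4) z by blast
      have "g k z \<le> mdist X c x + mdist X c y"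
        unfolding g_def using K(1)[of k] c z by (intro Min_le) auto
      moreover have "mdist X c y \<le> mdist X c x + mdist X x y"
        using X.triangle[of c x y] c z K(2)[of k] by auto
      ultimately show ?thesis using c by linarith
    qed
    have "(\<lambda>k. 1 / (real k + 1)) \<longlonglongrightarrow> 0"
      using LIMSEQ_inverse_real_of_nat by (simp add: inverse_eq_divide add.commute)
    then have "(\<lambda>k. mdist X x y + 2 * (1 / (real k + 1))) \<longlonglongrightarrow> mdist X x y + 2 * 0"
      by (intro tendsto_intros)
    then have *: "(\<lambda>k. mdist X x y + 2 * (1 / (real k + 1))) \<longlonglongrightarrow> mdist X x y" by simp
    have "(\<lambda>k. g k z) \<longlonglongrightarrow> mdist X x y"
      by (rule tendsto_sandwich[OF _ _ tendsto_const *]) (use lo hi in auto)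
    then show "(\<lambda>k. g k z) \<longlonglongrightarrow> mdist X (fst z) (snd z)" by (simp add: z)
  qed
qed

lemma (in prob_space) integrable_bounded:
  fixes g :: "'a \<Rightarrow> real"
  assumes "g \<in> borel_measurable M" "\<And>x. x \<in> space M \<Longrightarrow> \<bar>g x\<bar> \<le> B"
  shows "integrable M g"
  using assms by (intro integrable_const_bound[where B = B]) (auto intro!: AE_I2)

lemma integrable_mdist:
  assumes "mm_space X \<mu>" "x \<in> mspace X" "prob_space m" "sets m = sets \<mu>"
  shows "integrable m (mdist X x)"
proof -
  obtain D where D: "D > 0" "\<And>x y. x \<in> mspace X \<Longrightarrow> y \<in> mspace X \<Longrightarrow> mdist X x y \<le> D"
    using mm_space_diameter[OF assms(1)] by metis
  interpret m: prob_space m by fact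
  have "space m = mspace X"
    using sets_eq_imp_space_eq[OF assms(4)] mm_spaceD(4)[OF assms(1)] by simp
  then show ?thesis
    using measurable_mdist_const[OF assms(1,2)] measurable_cong_sets[OF assms(4) refl, of borel]
      D(2) assms(2) by (intro m.integrable_bounded[where B = D]) auto
qed

section \<open>Continuity and invariance of the mean distance\<close>

text \<open>Averaging the reverse triangle inequality over a probability measure keeps the constant
  1. The bound gives continuity and later controls the move from \<open>f x\<close> to a nearby
  point.\<close>

lemma mean_dist_Lipschitz:
  assumes "mm_space X \<mu>" "x \<in> mspace X" "x' \<in> mspace X"
  shows "\<bar>mean_dist X \<mu> x - mean_dist X \<mu> x'\<bar> \<le> mdist X x x'"
proof -
  interpret X: Metric_space "mspace X" "mdist X" by simp
  interpret prob_space \<mu> using mm_spaceD(1)[OF assms(1)] .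
  have I: "integrable \<mu> (mdist X x)" "integrable \<mu> (mdist X x')"
    using integrable_mdist[OF assms(1) _ prob_space_axioms refl] assms by auto
  have "\<bar>mean_dist X \<mu> x - mean_dist X \<mu> x'\<bar> = \<bar>\<integral>y. mdist X x y - mdist X x' y \<partial>\<mu>\<bar>"
    using I by (simp add: mean_dist_def)
  also have "\<dots> \<le> (\<integral>y. \<bar>mdist X x y - mdist X x' y\<bar> \<partial>\<mu>)"
    by (rule integral_abs_bound)
  also have "\<dots> \<le> (\<integral>y. mdist X x x' \<partial>\<mu>)"
  proof (rule integral_mono)
    fix y assume "y \<in> space \<mu>"
    then have "y \<in> mspace X" using mm_spaceD(4)[OF assms(1)] by simp
    then show "\<bar>mdist X x y - mdist X x' y\<bar> \<le> mdist X x x'"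
      using X.triangle[of x x' y] X.triangle[of x' x y] X.commute[of x x'] assms by auto
  qed (use I in auto)
  also have "\<dots> = mdist X x x'" by (simp add: prob_space)
  finally show ?thesis .
qed

lemma continuous_map_mean_dist:
  assumes "mm_space X \<mu>"
  shows "continuous_map (mtopology_of X) euclidean (mean_dist X \<mu>)"
proof -
  have "Lipschitz_continuous_map X euclidean_metric (mean_dist X \<mu>)"
    unfolding Lipschitz_continuous_map_def
    by (auto intro!: exI[of _ 1] simp: dist_real_def mean_dist_Lipschitz[OF assms])
  then have "continuous_map (mtopology_of X) (mtopology_of euclidean_metric) (mean_dist X \<mu>)"
    by (rule Lipschitz_continuous_imp_continuous_map)
  then show ?thesis by simp
qed

text \<open>Change of variables along a measure-preserving isometry. It is what makes separation by
  the mean distance a property of the isomorphism class.\<close>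

lemma mean_dist_iso:
  assumes "mm_space X \<mu>" "mm_space Y \<nu>" "mm_iso X \<mu> Y \<nu>"
  obtains f where "f ` mspace X = mspace Y"
    "\<And>x x'. x \<in> mspace X \<Longrightarrow> x' \<in> mspace X \<Longrightarrow> mdist Y (f x) (f x') = mdist X x x'"
    "\<And>x. x \<in> mspace X \<Longrightarrow> mean_dist Y \<nu> (f x) = mean_dist X \<mu> x"
proof -
  obtain f where f: "f ` mspace X = mspace Y"
      "\<And>x x'. x \<in> mspace X \<Longrightarrow> x' \<in> mspace X \<Longrightarrow> mdist Y (f x) (f x') = mdist X x x'"
      "f \<in> measurable \<mu> \<nu>" "distr \<mu> \<nu> f = \<nu>"
    using assms(3) unfolding mm_iso_def by blast
  have "mean_dist Y \<nu> (f x) = mean_dist X \<mu> x" if x: "x \<in> mspace X" for x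
  proof -
    have "f x \<in> mspace Y" using f(1) x by blast
    then have "mean_dist Y \<nu> (f x) = (\<integral>y. mdist Y (f x) (f y) \<partial>\<mu>)"
      unfolding mean_dist_def by (subst f(4)[symmetric])
        (intro integral_distr f(3) measurable_mdist_const[OF assms(2)])
    also have "\<dots> = mean_dist X \<mu> x"
      unfolding mean_dist_def using f(2) x mm_spaceD(4)[OF assms(1)]
      by (intro Bochner_Integration.integral_cong) auto
    finally show ?thesis .
  qed
  with f that show ?thesis by blast
qed

section \<open>Stability of the mean distance\<close>

text \<open>The independent coupling guarantees that the infimum defining \<open>wasserstein\<close>
  is taken over a nonempty set.\<close>

lemma pair_measure_couplings:
  assumes "prob_space m" "prob_space \<nu>"
  shows "m \<Otimes>\<^sub>M \<nu> \<in> couplings m \<nu>"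
proof -
  interpret m: prob_space m by fact
  interpret n: prob_space \<nu> by fact
  interpret P: pair_prob_space m \<nu> ..
  have "distr (m \<Otimes>\<^sub>M \<nu>) \<nu> snd = \<nu>"
  proof (rule measure_eqI)
    fix A assume A: "A \<in> sets (distr (m \<Otimes>\<^sub>M \<nu>) \<nu> snd)"
    then have "snd -` A \<inter> space (m \<Otimes>\<^sub>M \<nu>) = space m \<times> A"
      using sets.sets_into_space[of A \<nu>] by (auto simp: space_pair_measure)
    with A show "emeasure (distr (m \<Otimes>\<^sub>M \<nu>) \<nu> snd) A = emeasure \<nu> A"
      by (simp add: emeasure_distr n.emeasure_pair_measure_Times m.emeasure_space_1)
  qed simp
  then show ?thesis
    unfolding couplings_def using P.prob_space_axioms n.distr_pair_fst by simp
qed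

text \<open>An infimum over a nonempty set that lies strictly below \<open>a\<close> has a
  competitor below \<open>a\<close>.\<close>

lemma wasserstein_lessD:
  assumes "prob_space m" "prob_space \<nu>" "wasserstein p Y m \<nu> < a"
  obtains \<pi> where "\<pi> \<in> couplings m \<nu>"
    "(\<integral>z. mdist Y (fst z) (snd z) powr p \<partial>\<pi>) powr (1 / p) < a"
proof -
  have "couplings m \<nu> \<noteq> {}" using pair_measure_couplings[OF assms(1,2)] by blast
  then have "(\<lambda>\<pi>. (\<integral>z. mdist Y (fst z) (snd z) powr p \<partial>\<pi>) powr (1 / p)) ` couplings m \<nu> \<noteq> {}"
    by simp
  from cInf_lessD[OF this] assms(3) show ?thesis
    unfolding wasserstein_def using that by blast
qed

text \<open>Instead of Jensen's inequality, the elementary bound \<open>d \<le> a + a powr (1-p) * d powr p\<close>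
  suffices, at the cost of the factor 2.\<close>

lemma wasserstein_mean_dist:
  assumes Y: "mm_space Y \<nu>" and m: "prob_space m" "sets m = sets \<nu>"
    and p: "p \<ge> 1" and a: "a > 0" and W: "wasserstein p Y m \<nu> < a" and y: "y \<in> mspace Y"
  shows "\<bar>(\<integral>w. mdist Y y w \<partial>m) - mean_dist Y \<nu> y\<bar> \<le> 2 * a"
proof -
  interpret Y: Metric_space "mspace Y" "mdist Y" by simp
  obtain \<pi> where \<pi>: "\<pi> \<in> couplings m \<nu>"
      "(\<integral>z. mdist Y (fst z) (snd z) powr p \<partial>\<pi>) powr (1 / p) < a"
    using wasserstein_lessD[OF m(1) mm_spaceD(1)[OF Y] W] by metis
  then have "prob_space \<pi>" and s\<pi>: "sets \<pi> = sets (m \<Otimes>\<^sub>M \<nu>)"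
    and d1: "distr \<pi> m fst = m" and d2: "distr \<pi> \<nu> snd = \<nu>"
    by (auto simp: couplings_def)
  interpret prob_space \<pi> by fact
  obtain D where D: "D > 0" "\<And>x y. x \<in> mspace Y \<Longrightarrow> y \<in> mspace Y \<Longrightarrow> mdist Y x y \<le> D"
    using mm_space_diameter[OF Y] by metis
  have sp: "space \<pi> = mspace Y \<times> mspace Y"
    using sets_eq_imp_space_eq[OF s\<pi>] sets_eq_imp_space_eq[OF m(2)] mm_spaceD(4)[OF Y]
    by (simp add: space_pair_measure)
  have f1: "fst \<in> measurable \<pi> m" and f2: "snd \<in> measurable \<pi> \<nu>"
    using measurable_cong_sets[OF s\<pi> refl] by (blast intro: measurable_fst measurable_snd)+
  have dn: "mdist Y y \<in> borel_measurable \<nu>"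
    by (rule measurable_mdist_const[OF Y y])
  then have dm: "mdist Y y \<in> borel_measurable m"
    using measurable_cong_sets[OF m(2) refl] by blast
  \<comment> \<open>Both integrals are lifted to the coupling through its marginals, so that they
    can be compared pointwise.\<close>
  have e1: "(\<integral>w. mdist Y y w \<partial>m) = (\<integral>z. mdist Y y (fst z) \<partial>\<pi>)"
    using integral_distr[OF f1 dm] unfolding d1 .
  have e2: "mean_dist Y \<nu> y = (\<integral>z. mdist Y y (snd z) \<partial>\<pi>)"
    using integral_distr[OF f2 dn] unfolding d2 mean_dist_def .
  have md: "(\<lambda>z. mdist Y (fst z) (snd z)) \<in> borel_measurable \<pi>"
    by (rule measurable_mdist[OF Y m(2) refl s\<pi>])
  have I: "integrable \<pi> (\<lambda>z. mdist Y y (fst z))" "integrable \<pi> (\<lambda>z. mdist Y y (snd z))"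
    using measurable_compose[OF f1 dm] measurable_compose[OF f2 dn] D y
    by (auto intro!: integrable_bounded[where B = D] simp: sp)
  have Id: "integrable \<pi> (\<lambda>z. mdist Y (fst z) (snd z))"
    using md D by (auto intro!: integrable_bounded[where B = D] simp: sp)
  have Ip: "integrable \<pi> (\<lambda>z. mdist Y (fst z) (snd z) powr p)"
    using md D p by (auto intro!: integrable_bounded[where B = "D powr p"] powr_mono2 simp: sp)
  define E where "E = (\<integral>z. mdist Y (fst z) (snd z) powr p \<partial>\<pi>)"
  have "E \<ge> 0" unfolding E_def by (intro Bochner_Integration.integral_nonneg) simp
  have "E = (E powr (1/p)) powr p" using \<open>E \<ge> 0\<close> p by (simp add: powr_powr)
  also have "\<dots> \<le> a powr p"
    using \<pi>(2) p unfolding E_def[symmetric] by (intro powr_mono2) auto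
  finally have E: "E \<le> a powr p" .
  \<comment> \<open>For \<open>d\<close> beyond the threshold \<open>a\<close>, write
    \<open>d\<close> as \<open>d powr (1 - p) * d powr p\<close>; the first factor is at most
    \<open>a powr (1 - p)\<close> because the exponent is nonpositive.\<close>
  have pw: "d \<le> a + a powr (1 - p) * d powr p" if "d \<ge> 0" for d
  proof (cases "d \<le> a")
    case True
    then show ?thesis by (simp add: add_increasing2)
  next
    case False
    then have "d = d powr (1 - p) * d powr p" using a by (simp flip: powr_add)
    also have "\<dots> \<le> a powr (1 - p) * d powr p"
      using False a p by (intro mult_right_mono powr_mono2') auto
    finally show ?thesis using a by simp
  qed
  have "\<bar>(\<integral>w. mdist Y y w \<partial>m) - mean_dist Y \<nu> y\<bar>
      = \<bar>\<integral>z. mdist Y y (fst z) - mdist Y y (snd z) \<partial>\<pi>\<bar>"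
    using I by (simp add: e1 e2)
  also have "\<dots> \<le> (\<integral>z. \<bar>mdist Y y (fst z) - mdist Y y (snd z)\<bar> \<partial>\<pi>)"
    by (rule integral_abs_bound)
  also have "\<dots> \<le> (\<integral>z. a + a powr (1 - p) * mdist Y (fst z) (snd z) powr p \<partial>\<pi>)"
  proof (rule integral_mono)
    fix z assume "z \<in> space \<pi>"
    then obtain u v where z: "z = (u, v)" "u \<in> mspace Y" "v \<in> mspace Y" by (auto simp: sp)
    have "\<bar>mdist Y y u - mdist Y y v\<bar> \<le> mdist Y u v"
      using Y.triangle[of y u v] Y.triangle[of y v u] Y.commute[of u v] z y by auto
    then show "\<bar>mdist Y y (fst z) - mdist Y y (snd z)\<bar> \<le>
        a + a powr (1 - p) * mdist Y (fst z) (snd z) powr p"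
      using pw[of "mdist Y u v"] z by simp
  qed (use I Ip in auto)
  also have "\<dots> = a + a powr (1 - p) * E"
    unfolding E_def using Ip by (simp add: prob_space)
  also have "\<dots> \<le> a + a powr (1 - p) * a powr p"
    using E by (intro add_left_mono mult_left_mono) auto
  also have "\<dots> = 2 * a" using a by (simp flip: powr_add)
  finally show ?thesis .
qed

text \<open>The infimum yields a witness once its set is known to be nonempty. A constant map
  provides a member: it is a t-isometry for every t above both diameters, and t may also be taken
  above its transport cost.\<close>

lemma mm_dist_lessD:
  assumes X: "mm_space X \<mu>" and Y: "mm_space Y \<nu>" and "mm_dist p X \<mu> Y \<nu> < e"
  obtains t f where "0 < t" "t < e" "f \<in> measurable \<mu> \<nu>" "eps_isometry t X Y f"
    "wasserstein p Y (distr \<mu> \<nu> f) \<nu> \<le> t"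
proof -
  interpret X: Metric_space "mspace X" "mdist X" by simp
  interpret Y: Metric_space "mspace Y" "mdist Y" by simp
  let ?S = "{t. 0 < t \<and> (\<exists>f. f \<in> measurable \<mu> \<nu> \<and> eps_isometry t X Y f \<and>
                  wasserstein p Y (distr \<mu> \<nu> f) \<nu> \<le> t)}"
  obtain D where D: "D > 0" "\<And>x y. x \<in> mspace X \<Longrightarrow> y \<in> mspace X \<Longrightarrow> mdist X x y \<le> D"
    using mm_space_diameter[OF X] by metis
  obtain D' where D': "D' > 0" "\<And>x y. x \<in> mspace Y \<Longrightarrow> y \<in> mspace Y \<Longrightarrow> mdist Y x y \<le> D'"
    using mm_space_diameter[OF Y] by metis
  obtain x0 y0 where 0: "x0 \<in> mspace X" "y0 \<in> mspace Y"
    using mm_spaceD(5)[OF X] mm_spaceD(5)[OF Y] by blast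
  let ?f = "\<lambda>_. y0"
  let ?W = "wasserstein p Y (distr \<mu> \<nu> ?f) \<nu>"
  \<comment> \<open>\<open>D'\<close> covers the density of the image, \<open>D\<close> the
    distortion of a constant map, and the absolute value of \<open>?W\<close> the transport
    cost.\<close>
  let ?t = "D + D' + \<bar>?W\<bar> + 1"
  have "eps_isometry ?t X Y ?f"
    unfolding eps_isometry_def
  proof (intro conjI ballI)
    show "\<exists>x\<in>mspace X. mdist Y y0 y < ?t" if "y \<in> mspace Y" for y
      using 0 D D'(2)[OF 0(2) that] by (intro bexI[of _ x0]) auto
    show "\<bar>mdist Y y0 y0 - mdist X x x'\<bar> \<le> ?t" if "x \<in> mspace X" "x' \<in> mspace X" for x x'
      using D(2)[OF that] 0 D' by simp
  qed (use 0 in auto)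
  moreover have "?f \<in> measurable \<mu> \<nu>"
    using 0 mm_spaceD(4)[OF Y] by simp
  ultimately have "?t \<in> ?S" using D D' by (auto intro!: exI[of _ ?f])
  then have "?S \<noteq> {}" by blast
  from cInf_lessD[OF this] assms(3) show ?thesis
    unfolding mm_dist_def using that by blast
qed

text \<open>The error splits in two: replacing the push-forward of \<mu> by \<nu> costs at most 4t,
  and the distortion of distances under \<open>f\<close> costs at most another t.\<close>

lemma eps_isometry_mean_dist:
  assumes X: "mm_space X \<mu>" and Y: "mm_space Y \<nu>" and p: "p \<ge> 1" and t: "t > 0"
    and f: "f \<in> measurable \<mu> \<nu>" "eps_isometry t X Y f" "wasserstein p Y (distr \<mu> \<nu> f) \<nu> \<le> t"
    and x: "x \<in> mspace X"
  shows "\<bar>mean_dist Y \<nu> (f x) - mean_dist X \<mu> x\<bar> \<le> 5 * t"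
proof -
  interpret prob_space \<mu> using mm_spaceD(1)[OF X] .
  have fx: "f x' \<in> mspace Y" if "x' \<in> mspace X" for x'
    using f(2) that by (auto simp: eps_isometry_def)
  \<comment> \<open>The Wasserstein estimate asks for a strict inequality while only \<le> t is
    known, so it is applied with \<open>2 * t\<close>.\<close>
  have "\<bar>(\<integral>w. mdist Y (f x) w \<partial>distr \<mu> \<nu> f) - mean_dist Y \<nu> (f x)\<bar> \<le> 2 * (2 * t)"
    by (rule wasserstein_mean_dist[OF Y _ _ p]) (use t f fx x prob_space_distr in auto)
  also have dn: "mdist Y (f x) \<in> borel_measurable \<nu>"
    by (rule measurable_mdist_const[OF Y fx[OF x]])
  then have "(\<integral>w. mdist Y (f x) w \<partial>distr \<mu> \<nu> f) = (\<integral>x'. mdist Y (f x) (f x') \<partial>\<mu>)"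
    by (intro integral_distr f)
  finally have 1: "\<bar>(\<integral>x'. mdist Y (f x) (f x') \<partial>\<mu>) - mean_dist Y \<nu> (f x)\<bar> \<le> 4 * t" by simp
  obtain D where D: "D > 0" "\<And>x y. x \<in> mspace Y \<Longrightarrow> y \<in> mspace Y \<Longrightarrow> mdist Y x y \<le> D"
    using mm_space_diameter[OF Y] by metis
  have I: "integrable \<mu> (\<lambda>x'. mdist Y (f x) (f x'))" "integrable \<mu> (mdist X x)"
    using measurable_compose[OF f(1) dn] D fx x mm_spaceD(4)[OF X]
      integrable_mdist[OF X x prob_space_axioms refl]
    by (auto intro!: integrable_bounded[where B = D])
  have "\<bar>(\<integral>x'. mdist Y (f x) (f x') \<partial>\<mu>) - mean_dist X \<mu> x\<bar>
      = \<bar>\<integral>x'. mdist Y (f x) (f x') - mdist X x x' \<partial>\<mu>\<bar>"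
    using I by (simp add: mean_dist_def)
  also have "\<dots> \<le> (\<integral>x'. \<bar>mdist Y (f x) (f x') - mdist X x x'\<bar> \<partial>\<mu>)"
    by (rule integral_abs_bound)
  also have "\<dots> \<le> (\<integral>x'. t \<partial>\<mu>)"
    using I f(2) x mm_spaceD(4)[OF X] by (intro integral_mono) (auto simp: eps_isometry_def)
  also have "\<dots> = t" by (simp add: prob_space)
  finally show ?thesis using 1 by linarith
qed

section \<open>Uniformly separating mean distances\<close>

text \<open>The gap between \<open>s\<close> and \<open>r\<close> leaves room for the threshold to
  grow under a perturbation, which makes the condition open. Imposed for all positive
  \<open>r\<close>, it forces injectivity.\<close>

definition mean_separated :: "real \<Rightarrow> 'a metric \<Rightarrow> 'a measure \<Rightarrow> bool" where
  "mean_separated r X \<mu> \<longleftrightarrow> (\<exists>s<r. \<exists>\<delta>>0. \<forall>x\<in>mspace X. \<forall>x'\<in>mspace X.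
     s \<le> mdist X x x' \<longrightarrow> \<delta> \<le> \<bar>mean_dist X \<mu> x - mean_dist X \<mu> x'\<bar>)"

lemma mean_separated_iso:
  assumes "mm_space X \<mu>" "mm_space Y \<nu>" "mm_iso X \<mu> Y \<nu>" "mean_separated r X \<mu>"
  shows "mean_separated r Y \<nu>"
proof -
  obtain f where f: "f ` mspace X = mspace Y"
    "\<And>x x'. x \<in> mspace X \<Longrightarrow> x' \<in> mspace X \<Longrightarrow> mdist Y (f x) (f x') = mdist X x x'"
    "\<And>x. x \<in> mspace X \<Longrightarrow> mean_dist Y \<nu> (f x) = mean_dist X \<mu> x"
    using mean_dist_iso[OF assms(1-3)] by metis
  show ?thesis
    using assms(4) unfolding mean_separated_def f(1)[symmetric] by (auto simp: f(2,3))
qed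

text \<open>A pair in Y at distance at least the midpoint of \<open>s\<close> and \<open>r\<close>
  is traced back to a pair in X at distance at least \<open>s\<close>; at least half of the
  separation \<delta> survives the return to Y.\<close>

lemma mean_separated_nearby:
  assumes X: "mm_space X \<mu>" and p: "p \<ge> 1" and "mean_separated r X \<mu>"
  obtains e where "e > 0"
    "\<And>Y \<nu>. mm_space Y \<nu> \<Longrightarrow> mm_dist p X \<mu> Y \<nu> < e \<Longrightarrow> mean_separated r Y \<nu>"
proof -
  obtain s \<delta> where s: "s < r" "\<delta> > 0" "\<And>x x'. x \<in> mspace X \<Longrightarrow> x' \<in> mspace X \<Longrightarrow>
     s \<le> mdist X x x' \<Longrightarrow> \<delta> \<le> \<bar>mean_dist X \<mu> x - mean_dist X \<mu> x'\<bar>"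
    using assms(3) unfolding mean_separated_def by blast
  \<comment> \<open>Tracing a pair back loses at most 3t in distance and 12t in mean distance. For t
    below \<open>e\<close> these losses stay below \<open>(r - s) / 2\<close> and
    \<open>\<delta> / 2\<close>.\<close>
  define e where "e = min ((r - s) / 6) (\<delta> / 24)"
  have "mean_separated r Y \<nu>" if Y: "mm_space Y \<nu>" and d: "mm_dist p X \<mu> Y \<nu> < e" for Y \<nu>
  proof -
    interpret Y: Metric_space "mspace Y" "mdist Y" by simp
    obtain t f where t: "0 < t" "t < e" and f: "f \<in> measurable \<mu> \<nu>" "eps_isometry t X Y f"
        "wasserstein p Y (distr \<mu> \<nu> f) \<nu> \<le> t"
      using mm_dist_lessD[OF X Y d] by metis
    \<comment> \<open>The bound 6t is 5t for passing from \<open>x\<close> to \<open>f x\<close>,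
      plus t for moving from \<open>f x\<close> to \<open>y\<close> by the Lipschitz
      property.\<close>
    have approx: "\<exists>x\<in>mspace X. mdist Y (f x) y < t \<and> \<bar>mean_dist Y \<nu> y - mean_dist X \<mu> x\<bar> \<le> 6 * t"
      if y: "y \<in> mspace Y" for y
    proof -
      obtain x where x: "x \<in> mspace X" "mdist Y (f x) y < t" "f x \<in> mspace Y"
        using f(2) y unfolding eps_isometry_def by blast
      then show ?thesis
        using mean_dist_Lipschitz[OF Y x(3) y] eps_isometry_mean_dist[OF X Y p t(1) f x(1)] by force
    qed
    have "\<delta> / 2 \<le> \<bar>mean_dist Y \<nu> y - mean_dist Y \<nu> y'\<bar>"
      if y: "y \<in> mspace Y" "y' \<in> mspace Y" "(s + r) / 2 \<le> mdist Y y y'" for y y'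
    proof -
      obtain x where x: "x \<in> mspace X" "mdist Y (f x) y < t"
          "\<bar>mean_dist Y \<nu> y - mean_dist X \<mu> x\<bar> \<le> 6 * t"
        using approx[OF y(1)] by blast
      obtain x' where x': "x' \<in> mspace X" "mdist Y (f x') y' < t"
          "\<bar>mean_dist Y \<nu> y' - mean_dist X \<mu> x'\<bar> \<le> 6 * t"
        using approx[OF y(2)] by blast
      have m: "f x \<in> mspace Y" "f x' \<in> mspace Y"
        and iso: "\<bar>mdist Y (f x) (f x') - mdist X x x'\<bar> \<le> t"
        using f(2) x x' by (auto simp: eps_isometry_def)
      have "mdist Y y y' \<le> mdist Y (f x) y + mdist Y (f x) (f x') + mdist Y (f x') y'"
        using Y.triangle[of y "f x" y'] Y.triangle[of "f x" "f x'" y'] Y.commute[of y "f x"] m y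
        by simp
      then have "s \<le> mdist X x x'" using x(2) x'(2) iso y(3) t(2) by (auto simp: e_def)
      from s(3)[OF x(1) x'(1) this] show ?thesis
        using x(3) x'(3) t(2) unfolding e_def by linarith
    qed
    then show ?thesis
      unfolding mean_separated_def using s
      by (intro exI[of _ "(s + r) / 2"] exI[of _ "\<delta> / 2"] conjI) auto
  qed
  moreover have "e > 0" using s by (simp add: e_def)
  ultimately show ?thesis using that by blast
qed

section \<open>Separation as an open condition on isomorphism classes\<close>

lemma mm_iso_refl: "mm_iso X \<mu> X \<mu>"
  unfolding mm_iso_def by (intro exI[of _ id]) (auto simp: distr_id id_def)

definition separated_classes :: "real \<Rightarrow> (real metric \<times> real measure) set set" where
  "separated_classes r = {mm_class X \<mu> | X \<mu>. mm_space X \<mu> \<and> mean_separated r X \<mu>}"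

text \<open>Separation may be tested on any representative: a space lies in its own class, so
  equality of two classes supplies an isomorphism along which separation is transferred.\<close>

lemma mm_class_in_separated_classes:
  assumes "mm_space X \<mu>"
  shows "mm_class X \<mu> \<in> separated_classes r \<longleftrightarrow> mean_separated r X \<mu>"
proof
  assume "mm_class X \<mu> \<in> separated_classes r"
  then obtain X' \<mu>' where X': "mm_class X \<mu> = mm_class X' \<mu>'" "mm_space X' \<mu>'"
      "mean_separated r X' \<mu>'"
    unfolding separated_classes_def by blast
  have "(X, \<mu>) \<in> mm_class X \<mu>" using assms mm_iso_refl by (auto simp: mm_class_def)
  then have "mm_iso X' \<mu>' X \<mu>" unfolding X'(1) by (simp add: mm_class_def)
  then show "mean_separated r X \<mu>" using mean_separated_iso X' assms by blast
qed (use assms in \<open>auto simp: separated_classes_def\<close>)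

lemma openin_separated_classes:
  assumes "p \<ge> 1"
  shows "openin (mm_topology p) (separated_classes r)"
  unfolding openin_mm_topology mm_open_def
proof (intro conjI allI impI)
  show "separated_classes r \<subseteq> mm_classes"
    by (auto simp: separated_classes_def mm_classes_def)
  fix X \<mu> assume X: "mm_space X \<mu> \<and> mm_class X \<mu> \<in> separated_classes r"
  then obtain e where "e > 0"
    "\<And>Y \<nu>. mm_space Y \<nu> \<Longrightarrow> mm_dist p X \<mu> Y \<nu> < e \<Longrightarrow> mean_separated r Y (\<nu> :: real measure)"
    using mean_separated_nearby[of X \<mu> p r] assms mm_class_in_separated_classes by metis
  then show "\<exists>\<epsilon>>0. \<forall>Y \<nu>. mm_space Y \<nu> \<and> mm_dist p X \<mu> Y \<nu> < \<epsilon> \<longrightarrow>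
      mm_class Y \<nu> \<in> separated_classes r"
    using mm_class_in_separated_classes by blast
qed

text \<open>Two distinct points are further apart than some \<open>inverse (real (Suc n))\<close>,
  and separation at that scale keeps their mean distances apart.\<close>

lemma inj_on_mean_dist:
  assumes "\<And>n. mean_separated (inverse (real (Suc n))) X \<mu>"
  shows "inj_on (mean_dist X \<mu>) (mspace X)"
proof (rule inj_onI, rule ccontr)
  interpret X: Metric_space "mspace X" "mdist X" by simp
  fix x y assume xy: "x \<in> mspace X" "y \<in> mspace X" "mean_dist X \<mu> x = mean_dist X \<mu> y" "x \<noteq> y"
  then have "0 < mdist X x y" by simp
  then obtain n where n: "inverse (real (Suc n)) < mdist X x y"
    using reals_Archimedean by blast
  obtain s \<delta> where "s < inverse (real (Suc n))" "\<delta> > 0"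
    "\<forall>x\<in>mspace X. \<forall>x'\<in>mspace X. s \<le> mdist X x x' \<longrightarrow> \<delta> \<le> \<bar>mean_dist X \<mu> x - mean_dist X \<mu> x'\<bar>"
    using assms[of n] unfolding mean_separated_def by blast
  with n xy show False by force
qed

section \<open>Spaces with injective mean distance\<close>

locale injective_mean_dist =
  fixes X :: "'a metric" and \<mu> :: "'a measure"
  assumes mm: "mm_space X \<mu>" and inj: "inj_on (mean_dist X \<mu>) (mspace X)"
begin

abbreviation \<phi> where "\<phi> \<equiv> mean_dist X \<mu>"

definition S where "S = \<phi> ` mspace X"

definition \<psi> where "\<psi> = the_inv_into (mspace X) \<phi>"

text \<open>As \<phi> is a homeomorphism onto the compact set \<open>S\<close>, this identifies the
  continuous functions on \<open>S \<times> S\<close> with \<open>C2 X\<close>. Algebra and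
  approximation can then be done in the plane.\<close>

definition pull :: "(real \<times> real \<Rightarrow> complex) \<Rightarrow> 'a \<times> 'a \<Rightarrow> complex" where
  "pull h = (\<lambda>z\<in>mspace X \<times> mspace X. h (\<phi> (fst z), \<phi> (snd z)))"

lemma psi_phi [simp]: "x \<in> mspace X \<Longrightarrow> \<psi> (\<phi> x) = x"
  using inj by (simp add: \<psi>_def the_inv_into_f_f)

lemma phi_in_S [simp]: "x \<in> mspace X \<Longrightarrow> \<phi> x \<in> S"
  by (simp add: S_def)

lemma psi_in [simp]: "a \<in> S \<Longrightarrow> \<psi> a \<in> mspace X"
  by (auto simp: S_def)

lemma continuous_map_phi: "continuous_map (mtopology_of X) (top_of_set S) \<phi>"
  using continuous_map_mean_dist[OF mm] by (auto simp: continuous_map_in_subtopology)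

text \<open>A continuous injection from a compact space into a Hausdorff space has a continuous
  inverse on its image.\<close>

lemma continuous_map_psi: "continuous_map (top_of_set S) (mtopology_of X) \<psi>"
  unfolding S_def
  using continuous_inverse_map[OF mm_spaceD(2)[OF mm] Hausdorff_space_euclidean
      continuous_map_mean_dist[OF mm], of \<psi> S] by (simp add: S_def)

lemma compact_S: "compact S"
  unfolding S_def using image_compactin[of "mtopology_of X" "mspace X" euclidean \<phi>]
    continuous_map_mean_dist[OF mm] mm_spaceD(2)[OF mm] by (simp add: compact_space_def)

lemma continuous_map_phi2:
  "continuous_map (prod_topology (mtopology_of X) (mtopology_of X)) (top_of_set (S \<times> S))
     (\<lambda>z. (\<phi> (fst z), \<phi> (snd z)))"
  unfolding prod_topology_subtopology_eu[symmetric] continuous_map_pairwise o_def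
    fst_conv snd_conv
  by (intro conjI continuous_map_compose[OF continuous_map_fst continuous_map_phi, unfolded o_def]
      continuous_map_compose[OF continuous_map_snd continuous_map_phi, unfolded o_def])

lemma continuous_map_psi2:
  "continuous_map (top_of_set (S \<times> S)) (prod_topology (mtopology_of X) (mtopology_of X))
     (\<lambda>z. (\<psi> (fst z), \<psi> (snd z)))"
  unfolding prod_topology_subtopology_eu[symmetric] continuous_map_pairwise o_def
    fst_conv snd_conv
  by (intro conjI continuous_map_compose[OF continuous_map_fst continuous_map_psi, unfolded o_def]
      continuous_map_compose[OF continuous_map_snd continuous_map_psi, unfolded o_def])

text \<open>Besides continuity, \<open>cfunspace\<close> demands boundedness, which comes from
  compactness of \<open>S \<times> S\<close>.\<close>

lemma pull_in_C2:
  assumes "continuous_on (S \<times> S) h"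
  shows "pull h \<in> mspace (C2 X)"
proof -
  let ?P = "prod_topology (mtopology_of X) (mtopology_of X)"
  have "continuous_map ?P euclidean (h \<circ> (\<lambda>z. (\<phi> (fst z), \<phi> (snd z))))"
    by (rule continuous_map_compose[OF continuous_map_phi2]) (use assms in simp)
  then have c: "continuous_map ?P euclidean (pull h)"
    by (rule continuous_map_eq) (auto simp: pull_def)
  have "bounded (h ` (S \<times> S))"
    using assms compact_S by (intro compact_imp_bounded compact_continuous_image compact_Times)
  moreover have "pull h ` (mspace X \<times> mspace X) \<subseteq> h ` (S \<times> S)"
    by (auto simp: pull_def)
  ultimately have "bounded (pull h ` (mspace X \<times> mspace X))"
    by (rule bounded_subset)
  with c show ?thesis
    by (auto simp: pull_def)
qed

text \<open>Composing with \<psi> in both variables inverts \<open>pull\<close>; extensionality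
  settles the values outside \<open>mspace X \<times> mspace X\<close>.\<close>

lemma C2E:
  assumes "f \<in> mspace (C2 X)"
  obtains h where "continuous_on (S \<times> S) h" "f = pull h"
proof
  let ?h = "\<lambda>z. f (\<psi> (fst z), \<psi> (snd z))"
  have "continuous_map (prod_topology (mtopology_of X) (mtopology_of X)) euclidean f"
    using assms by simp
  from continuous_map_compose[OF continuous_map_psi2 this]
  show "continuous_on (S \<times> S) ?h" by (simp add: o_def)
  have "f \<in> extensional (mspace X \<times> mspace X)" using assms by simp
  then show "f = pull ?h"
    by (intro extensionalityI[of _ "mspace X \<times> mspace X"]) (auto simp: pull_def)
qed

text \<open>These identities, with the two lemmas that follow, reduce closure properties of
  \<open>C2 X\<close> to continuity statements on \<open>S \<times> S\<close>.\<close>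

lemma pull_add: "(\<lambda>z\<in>mspace X \<times> mspace X. pull h z + pull k z) = pull (\<lambda>z. h z + k z)"
  and pull_mult: "(\<lambda>z\<in>mspace X \<times> mspace X. pull h z * pull k z) = pull (\<lambda>z. h z * k z)"
  and pull_cmult: "(\<lambda>z\<in>mspace X \<times> mspace X. c * pull h z) = pull (\<lambda>z. c * h z)"
  and pull_cnj: "(\<lambda>z\<in>mspace X \<times> mspace X. cnj (pull h z)) = pull (\<lambda>z. cnj (h z))"
  and pull_swap: "(\<lambda>z\<in>mspace X \<times> mspace X. pull h (snd z, fst z)) = pull (\<lambda>z. h (snd z, fst z))"
  and pull_const: "(\<lambda>z\<in>mspace X \<times> mspace X. c) = pull (\<lambda>z. c)"
  by (auto simp: pull_def fun_eq_iff restrict_def)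

lemma pull_mdist: "(\<lambda>z\<in>mspace X \<times> mspace X. complex_of_real (mdist X (fst z) (snd z))) =
   pull (\<lambda>z. complex_of_real (mdist X (\<psi> (fst z)) (\<psi> (snd z))))"
  by (auto simp: pull_def fun_eq_iff restrict_def)

lemma pull_convolution:
  "convolution X \<mu> (pull h) (pull k) = pull (\<lambda>z. \<integral>y. h (fst z, \<phi> y) * k (\<phi> y, snd z) \<partial>\<mu>)"
  unfolding convolution_def pull_def
  by (intro restrict_ext Bochner_Integration.integral_cong) (auto simp: mm_spaceD(4)[OF mm])

text \<open>Dominated convergence along sequences in \<open>S \<times> S\<close>; the product of the
  suprema of \<open>h\<close> and \<open>k\<close> supplies a constant majorant.\<close>

lemma continuous_on_convolution:
  fixes h k :: "real \<times> real \<Rightarrow> complex"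
  assumes h: "continuous_on (S \<times> S) h" and k: "continuous_on (S \<times> S) k"
  shows "continuous_on (S \<times> S) (\<lambda>z. \<integral>y. h (fst z, \<phi> y) * k (\<phi> y, snd z) \<partial>\<mu>)"
proof -
  interpret prob_space \<mu> using mm_spaceD(1)[OF mm] .
  note sp = mm_spaceD(4)[OF mm]
  have "bounded (h ` (S \<times> S))" "bounded (k ` (S \<times> S))"
    using h k compact_S by (intro compact_imp_bounded compact_continuous_image compact_Times; simp)+
  then obtain B B' where B: "\<And>z. z \<in> S \<times> S \<Longrightarrow> norm (h z) \<le> B"
      "\<And>z. z \<in> S \<times> S \<Longrightarrow> norm (k z) \<le> B'"
    unfolding bounded_iff by (metis imageI)
  \<comment> \<open>The integrand factors through \<phi> as a continuous function on
    \<open>S\<close>, hence is continuous on X and therefore measurable.\<close>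
  have m: "(\<lambda>y. h (a, \<phi> y) * k (\<phi> y, b)) \<in> borel_measurable \<mu>" if "a \<in> S" "b \<in> S" for a b
  proof -
    have "continuous_on S (\<lambda>t. h (a, t) * k (t, b))"
      using that by (auto intro!: continuous_intros continuous_on_compose2[OF h] continuous_on_compose2[OF k])
    then have "continuous_map (mtopology_of X) euclidean ((\<lambda>t. h (a, t) * k (t, b)) \<circ> \<phi>)"
      by (intro continuous_map_compose[OF continuous_map_phi]) simp
    then show ?thesis
      using continuous_map_measurable[OF mm] by (simp add: o_def)
  qed
  show ?thesis
  proof (rule continuous_on_sequentiallyI)
    fix u and z :: "real \<times> real"
    assume u: "\<forall>n. u n \<in> S \<times> S" and z: "z \<in> S \<times> S" and lim: "u \<longlonglongrightarrow> z"
    show "(\<lambda>n. \<integral>y. h (fst (u n), \<phi> y) * k (\<phi> y, snd (u n)) \<partial>\<mu>) \<longlonglongrightarrow>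
        (\<integral>y. h (fst z, \<phi> y) * k (\<phi> y, snd z) \<partial>\<mu>)"
    proof (rule integral_dominated_convergence[where w = "\<lambda>_. B * B'"])
      show "(\<lambda>y. h (fst z, \<phi> y) * k (\<phi> y, snd z)) \<in> borel_measurable \<mu>"
        using z by (intro m) auto
      show "(\<lambda>y. h (fst (u n), \<phi> y) * k (\<phi> y, snd (u n))) \<in> borel_measurable \<mu>" for n
        using u by (intro m) (auto simp: mem_Times_iff)
      show "AE y in \<mu>. (\<lambda>n. h (fst (u n), \<phi> y) * k (\<phi> y, snd (u n))) \<longlonglongrightarrow>
          h (fst z, \<phi> y) * k (\<phi> y, snd z)"
      proof (rule AE_I2, rule tendsto_mult)
        fix y assume "y \<in> space \<mu>"
        then have y: "\<phi> y \<in> S" using sp by simp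
        show "(\<lambda>n. h (fst (u n), \<phi> y)) \<longlonglongrightarrow> h (fst z, \<phi> y)"
          using u z y lim
          by (intro continuous_on_tendsto_compose[OF h] tendsto_intros) (auto simp: mem_Times_iff)
        show "(\<lambda>n. k (\<phi> y, snd (u n))) \<longlonglongrightarrow> k (\<phi> y, snd z)"
          using u z y lim
          by (intro continuous_on_tendsto_compose[OF k] tendsto_intros) (auto simp: mem_Times_iff)
      qed
      show "AE y in \<mu>. norm (h (fst (u n), \<phi> y) * k (\<phi> y, snd (u n))) \<le> B * B'" for n
      proof (rule AE_I2)
        fix y assume "y \<in> space \<mu>"
        then have y: "\<phi> y \<in> S" using sp by simp
        have "norm (h (fst (u n), \<phi> y)) \<le> B" "norm (k (\<phi> y, snd (u n))) \<le> B'"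
          using u y by (auto intro!: B simp: mem_Times_iff)
        then show "norm (h (fst (u n), \<phi> y) * k (\<phi> y, snd (u n))) \<le> B * B'"
          by (simp add: norm_mult mult_mono')
      qed
    qed simp
  qed
qed

section \<open>The coherent algebra is all of C(X \<times> X)\<close>

text \<open>This bounds the intersection defining \<open>Coh\<close> from above: the full function
  space is itself one of the algebras being intersected.\<close>

lemma coherent_subalgebra_C2: "coherent_subalgebra X \<mu> (mspace (C2 X))"
  unfolding coherent_subalgebra_def unital_cstar_subalgebra_def
proof (intro conjI ballI allI)
  show "closedin (mtopology_of (C2 X)) (mspace (C2 X))"
    using closedin_topspace[of "mtopology_of (C2 X)"] unfolding topspace_mtopology_of .
  show "(\<lambda>z\<in>mspace X \<times> mspace X. 1) \<in> mspace (C2 X)"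
    unfolding pull_const by (intro pull_in_C2 continuous_intros)
  have "continuous_map (top_of_set (S \<times> S)) euclidean (\<lambda>z. mdist X (\<psi> (fst z)) (\<psi> (snd z)))"
    using continuous_map_psi2
    by (intro continuous_map_mdist) (simp_all add: continuous_map_pairwise o_def)
  then show "(\<lambda>z\<in>mspace X \<times> mspace X. complex_of_real (mdist X (fst z) (snd z))) \<in> mspace (C2 X)"
    unfolding pull_mdist by (intro pull_in_C2 continuous_intros) simp
  fix f assume f: "f \<in> mspace (C2 X)"
  obtain h where h: "continuous_on (S \<times> S) h" "f = pull h" using C2E[OF f] .
  show "(\<lambda>z\<in>mspace X \<times> mspace X. c * f z) \<in> mspace (C2 X)" for c
    unfolding h(2) pull_cmult by (intro pull_in_C2 continuous_intros h)
  show "(\<lambda>z\<in>mspace X \<times> mspace X. cnj (f z)) \<in> mspace (C2 X)"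
    unfolding h(2) pull_cnj by (intro pull_in_C2 continuous_intros h)
  show "(\<lambda>z\<in>mspace X \<times> mspace X. f (snd z, fst z)) \<in> mspace (C2 X)"
    unfolding h(2) pull_swap
    by (intro pull_in_C2 continuous_on_compose2[OF h(1)] continuous_intros) auto
  fix g assume g: "g \<in> mspace (C2 X)"
  obtain k where k: "continuous_on (S \<times> S) k" "g = pull k" using C2E[OF g] .
  show "(\<lambda>z\<in>mspace X \<times> mspace X. f z + g z) \<in> mspace (C2 X)"
    unfolding h(2) k(2) pull_add by (intro pull_in_C2 continuous_intros h k)
  show "(\<lambda>z\<in>mspace X \<times> mspace X. f z * g z) \<in> mspace (C2 X)"
    unfolding h(2) k(2) pull_mult by (intro pull_in_C2 continuous_intros h k)
  show "convolution X \<mu> f g \<in> mspace (C2 X)"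
    unfolding h(2) k(2) pull_convolution by (intro pull_in_C2 continuous_on_convolution h k)
qed simp

text \<open>Under \<open>pull\<close>, the convolution d * 1 is the first coordinate function and
  its flip the second. Together with the unit they generate all polynomials.\<close>

lemma pull_polynomial_in_coherent:
  assumes A: "coherent_subalgebra X \<mu> A" and p: "real_polynomial_function p"
  shows "pull (\<lambda>z. complex_of_real (p z)) \<in> A"
proof -
  have one: "pull (\<lambda>z. 1) \<in> A"
    using A unfolding coherent_subalgebra_def unital_cstar_subalgebra_def pull_const by blast
  have add: "pull (\<lambda>z. h z + k z) \<in> A" if "pull h \<in> A" "pull k \<in> A" for h k
    using A that unfolding coherent_subalgebra_def unital_cstar_subalgebra_def pull_add[symmetric] by blast
  have mult: "pull (\<lambda>z. h z * k z) \<in> A" if "pull h \<in> A" "pull k \<in> A" for h k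
    using A that unfolding coherent_subalgebra_def unital_cstar_subalgebra_def pull_mult[symmetric] by blast
  have cmult: "pull (\<lambda>z. c * h z) \<in> A" if "pull h \<in> A" for h c
    using A that unfolding coherent_subalgebra_def unital_cstar_subalgebra_def pull_cmult[symmetric] by blast
  have "convolution X \<mu> (\<lambda>z\<in>mspace X \<times> mspace X. complex_of_real (mdist X (fst z) (snd z)))
      (pull (\<lambda>z. 1)) \<in> A"
    using A one unfolding coherent_subalgebra_def by blast
  also have "convolution X \<mu> (\<lambda>z\<in>mspace X \<times> mspace X. complex_of_real (mdist X (fst z) (snd z)))
      (pull (\<lambda>z. 1)) = pull (\<lambda>z. complex_of_real (fst z))"
  proof -
    have "(\<integral>y. complex_of_real (mdist X x y) \<partial>\<mu>) = complex_of_real (\<phi> x)" for x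
      by (simp add: mean_dist_def)
    moreover have "(\<integral>y. (\<lambda>z\<in>mspace X \<times> mspace X. complex_of_real (mdist X (fst z) (snd z))) (x, y) *
        pull (\<lambda>z. 1) (y, x') \<partial>\<mu>) = (\<integral>y. complex_of_real (mdist X x y) \<partial>\<mu>)"
      if "x \<in> mspace X" "x' \<in> mspace X" for x x'
      using that by (intro Bochner_Integration.integral_cong) (auto simp: pull_def mm_spaceD(4)[OF mm])
    ultimately show ?thesis
      unfolding convolution_def by (auto simp: pull_def intro!: restrict_ext)
  qed
  finally have fst: "pull (\<lambda>z. complex_of_real (fst z)) \<in> A" .
  then have "(\<lambda>z\<in>mspace X \<times> mspace X. pull (\<lambda>z. complex_of_real (fst z)) (snd z, fst z)) \<in> A"
    using A unfolding coherent_subalgebra_def by blast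
  then have snd: "pull (\<lambda>z. complex_of_real (snd z)) \<in> A" by (simp add: pull_swap)
  from p show ?thesis
  proof induction
    case (linear f)
    then interpret f: bounded_linear f .
    \<comment> \<open>The base case of the induction is an arbitrary linear functional on the plane,
      which is a combination of the two coordinates.\<close>
    have "f z = f (1, 0) * fst z + f (0, 1) * snd z" for z
      using f.add[of "fst z *\<^sub>R (1, 0)" "snd z *\<^sub>R (0, 1)"]
        f.scaleR[of "fst z" "(1, 0)"] f.scaleR[of "snd z" "(0, 1)"]
      by (simp add: mult.commute)
    then have "(\<lambda>z. complex_of_real (f z)) = (\<lambda>z. complex_of_real (f (1, 0)) * complex_of_real (fst z)
        + complex_of_real (f (0, 1)) * complex_of_real (snd z))"
      by (metis of_real_add of_real_mult)
    then show ?case using add[OF cmult[OF fst] cmult[OF snd]] by simp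
  next
    case (const c)
    then show ?case using cmult[OF one, of "complex_of_real c"] by simp
  next
    case (add f g)
    then show ?case using \<open>\<And>h k. pull h \<in> A \<Longrightarrow> pull k \<in> A \<Longrightarrow> pull (\<lambda>z. h z + k z) \<in> A\<close> by simp
  next
    case (mult f g)
    then show ?case using \<open>\<And>h k. pull h \<in> A \<Longrightarrow> pull k \<in> A \<Longrightarrow> pull (\<lambda>z. h z * k z) \<in> A\<close> by simp
  qed
qed

text \<open>A function outside the closed set \<open>A\<close> has a ball disjoint from
  \<open>A\<close>; by Stone--Weierstrass some polynomial in the two coordinates lies in that ball,
  and its pullback belongs to \<open>A\<close>.\<close>

lemma coherent_subalgebra_full:
  assumes A: "coherent_subalgebra X \<mu> A"
  shows "mspace (C2 X) \<subseteq> A"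
proof (rule subsetI, rule ccontr)
  interpret C: Metric_space "mspace (C2 X)" "mdist (C2 X)" by (rule Metric_space_mspace_mdist)
  have cl: "closedin C.mtopology A" and sub: "A \<subseteq> mspace (C2 X)"
    and add: "\<And>f g. f \<in> A \<Longrightarrow> g \<in> A \<Longrightarrow> (\<lambda>z\<in>mspace X \<times> mspace X. f z + g z) \<in> A"
    and cmult: "\<And>c f. f \<in> A \<Longrightarrow> (\<lambda>z\<in>mspace X \<times> mspace X. c * f z) \<in> A"
    using A unfolding coherent_subalgebra_def unital_cstar_subalgebra_def mtopology_of_def by blast+
  fix f assume f: "f \<in> mspace (C2 X)" "f \<notin> A"
  then obtain r where r: "r > 0" "disjnt A (C.mball f r)"
    using cl unfolding C.closedin_metric by blast
  obtain h where h: "continuous_on (S \<times> S) h" "f = pull h" using C2E[OF f(1)] .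
  \<comment> \<open>Half the radius is used because pointwise bounds give only a non-strict bound on
    the supremum metric.\<close>
  obtain q where q: "polynomial_function q" "\<And>z. z \<in> S \<times> S \<Longrightarrow> norm (h z - q z) < r / 2"
    using Stone_Weierstrass_polynomial_function[OF compact_Times[OF compact_S compact_S] h(1), of "r / 2"]
      r(1) by auto
  \<comment> \<open>Splitting into real and imaginary parts reduces a complex polynomial to two real
    ones, recombined by the complex linear structure of \<open>A\<close>.\<close>
  have "real_polynomial_function (Re \<circ> q)" "real_polynomial_function (Im \<circ> q)"
    using q(1) bounded_linear_Re bounded_linear_Im unfolding polynomial_function_def by blast+
  then have "pull (\<lambda>z. complex_of_real (Re (q z))) \<in> A" "pull (\<lambda>z. complex_of_real (Im (q z))) \<in> A"
    using pull_polynomial_in_coherent[OF A] by fastforce+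
  then have "pull (\<lambda>z. complex_of_real (Re (q z)) + \<i> * complex_of_real (Im (q z))) \<in> A"
    using add cmult unfolding pull_add[symmetric] pull_cmult[symmetric] by blast
  then have qA: "pull q \<in> A" by (simp flip: complex_eq)
  have "mdist (C2 X) f (pull q) \<le> r / 2"
    using q(2) r(1) by (intro mdist_cfunspace_le) (auto simp: h(2) pull_def dist_norm less_imp_le)
  then have "pull q \<in> C.mball f r"
    using r(1) qA sub f(1) unfolding C.in_mball by auto
  with r(2) qA show False by (auto simp: disjnt_iff)
qed

lemma Coh_full: "Coh X \<mu> = mspace (C2 X)"
  unfolding Coh_def using coherent_subalgebra_C2 coherent_subalgebra_full by blast

end

section \<open>Density\<close>

text \<open>Finitely many pairs of distinct points produce finitely many positive differences, and
  these have a positive minimum.\<close>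

lemma mean_separated_finite:
  assumes "finite (mspace X)" "inj_on (mean_dist X \<mu>) (mspace X)" "r > 0"
  shows "mean_separated r X \<mu>"
proof -
  define V where "V = (\<lambda>(x, x'). \<bar>mean_dist X \<mu> x - mean_dist X \<mu> x'\<bar>) `
    {(x, x') \<in> mspace X \<times> mspace X. x \<noteq> x'}"
  have "finite V" using assms(1) unfolding V_def
    by (intro finite_imageI finite_subset[OF _ finite_cartesian_product[OF assms(1,1)]]) auto
  moreover have "v > 0" if "v \<in> V" for v
    using that assms(2) by (auto simp: V_def inj_on_def)
  \<comment> \<open>The extra element 1 covers the case of at most one point, where \<open>V\<close>
    is empty.\<close>
  ultimately have pos: "Min (insert 1 V) > 0"
    by (subst Min_gr_iff) auto
  \<comment> \<open>The threshold \<open>r / 2\<close> is below \<open>r\<close>, as the definition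
    requires, and positive, which excludes pairs of equal points.\<close>
  have "Min (insert 1 V) \<le> \<bar>mean_dist X \<mu> x - mean_dist X \<mu> x'\<bar>"
    if "x \<in> mspace X" "x' \<in> mspace X" "r / 2 \<le> mdist X x x'" for x x'
  proof -
    have "mdist X x x' \<noteq> 0" using that(3) assms(3) by linarith
    then have "x \<noteq> x'" using that(1,2) by simp
    then show ?thesis using that \<open>finite V\<close> by (intro Min_le) (auto simp: V_def)
  qed
  then show ?thesis
    unfolding mean_separated_def using pos assms(3)
    by (intro exI[of _ "r / 2"] exI[of _ "Min (insert 1 V)"] conjI) auto
qed

text \<open>Take \<open>a k = t ^ Suc (idx k)\<close>: each coincidence of two values is a nontrivial polynomial
  equation in \<open>t\<close>, so all but finitely many \<open>t\<close> work.\<close>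

lemma generic_weights:
  fixes d :: "'a \<Rightarrow> 'a \<Rightarrow> real" and m :: "'a \<Rightarrow> real"
  assumes K: "finite K" "K \<noteq> {}" and d: "\<And>i j. i \<in> K \<Longrightarrow> j \<in> K \<Longrightarrow> i \<noteq> j \<Longrightarrow> d i i \<noteq> d j i"
    and e: "e > 0"
  obtains a where "\<forall>k\<in>K. a k > 0" "sum a K \<le> e"
    "inj_on (\<lambda>i. \<Sum>k\<in>K. (m k + a k) * d i k) K"
proof -
  define idx where "idx = to_nat_on K"
  have idx: "inj_on idx K"
    unfolding idx_def by (intro inj_on_to_nat_on countable_finite K(1))
  \<comment> \<open>At t, \<open>P i j\<close> is the difference of the weighted sums for
    \<open>i\<close> and \<open>j\<close>. Exponents start at 1, so the added weights shrink with t
    and do not mix with the constant term.\<close>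
  define P where "P i j = [:\<Sum>k\<in>K. m k * (d i k - d j k):] +
      (\<Sum>k\<in>K. monom (d i k - d j k) (Suc (idx k)))" for i j
  have polyP: "poly (P i j) t = (\<Sum>k\<in>K. (m k + t ^ Suc (idx k)) * d i k) -
      (\<Sum>k\<in>K. (m k + t ^ Suc (idx k)) * d j k)" for i j t
    unfolding P_def sum_subtractf[symmetric]
    by (simp add: poly_sum poly_monom algebra_simps flip: sum.distrib sum_subtractf)
  have nz: "P i j \<noteq> 0" if "i \<in> K" "j \<in> K" "i \<noteq> j" for i j
  proof -
    \<comment> \<open>Since \<open>idx\<close> is injective, only the summand \<open>k = i\<close>
      reaches this coefficient, and there the hypothesis on \<open>d\<close> applies.\<close>
    have "coeff (P i j) (Suc (idx i)) = (\<Sum>k\<in>K. if k = i then d i k - d j k else 0)"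
      unfolding P_def using that idx
      by (auto simp: coeff_sum inj_on_eq_iff intro!: sum.cong)
    also have "\<dots> = d i i - d j i" using that K(1) by simp
    finally show ?thesis using d[OF that] by auto
  qed
  define B where "B = (\<Union>(i, j)\<in>{(i, j) \<in> K \<times> K. i \<noteq> j}. {t. poly (P i j) t = 0})"
  have "finite B"
    unfolding B_def
    using K(1) nz by (intro finite_UN_I finite_subset[OF _ finite_cartesian_product[OF K(1) K(1)]])
      (auto intro!: poly_roots_finite)
  \<comment> \<open>Below 1 every positive power of t is at most t, so each weight is at most
    \<open>e / card K\<close> and their sum at most \<open>e\<close>.\<close>
  define \<tau> where "\<tau> = min 1 (e / card K)"
  have "\<tau> > 0" using e K by (auto simp: \<tau>_def card_gt_0_iff)
  then have "infinite {0<..<\<tau>}" by simp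
  then have "\<not> {0<..<\<tau>} \<subseteq> B" using \<open>finite B\<close> finite_subset by blast
  then obtain t where "t \<in> {0<..<\<tau>}" and "t \<notin> B" by blast
  then have t: "0 < t" "t < \<tau>" "t \<notin> B" by simp_all
  show ?thesis
  proof (rule that[of "\<lambda>k. t ^ Suc (idx k)"])
    show "\<forall>k\<in>K. t ^ Suc (idx k) > 0" using t by simp
    have "t ^ Suc n \<le> e / card K" for n
    proof -
      have "t ^ Suc n \<le> t ^ 1" using t by (intro power_decreasing) (auto simp: \<tau>_def)
      also have "t ^ 1 \<le> e / card K" using t by (simp add: \<tau>_def)
      finally show ?thesis .
    qed
    then have "(\<Sum>k\<in>K. t ^ Suc (idx k)) \<le> of_nat (card K) * (e / card K)"
      by (intro sum_bounded_above)
    also have "\<dots> = e" using K by simp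
    finally show "(\<Sum>k\<in>K. t ^ Suc (idx k)) \<le> e" .
    show "inj_on (\<lambda>i. \<Sum>k\<in>K. (m k + t ^ Suc (idx k)) * d i k) K"
    proof (rule inj_onI, rule ccontr)
      fix i j assume ij: "i \<in> K" "j \<in> K" "i \<noteq> j"
        "(\<Sum>k\<in>K. (m k + t ^ Suc (idx k)) * d i k) = (\<Sum>k\<in>K. (m k + t ^ Suc (idx k)) * d j k)"
      then have "poly (P i j) t = 0" by (simp add: polyP)
      with ij t(3) show False by (auto simp: B_def)
    qed
  qed
qed

text \<open>The coupling keeps the mass \<open>M / (1 + T)\<close> on the diagonal and couples the remaining
  \<open>T / (1 + T)\<close> of \<open>M\<close> independently with the added weights.\<close>

lemma wasserstein_perturbed_le:
  assumes K: "finite K" "K \<subseteq> mspace Y" and D: "\<And>x y. x \<in> K \<Longrightarrow> y \<in> K \<Longrightarrow> mdist Y x y \<le> D"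
    and M: "prob_space M" "sets M = Pow K" and a: "\<And>k. k \<in> K \<Longrightarrow> a k \<ge> 0" and p: "p \<ge> 1"
  defines "T \<equiv> sum a K"
  defines "\<nu> \<equiv> point_measure K (\<lambda>k. ennreal ((measure M {k} + a k) / (1 + T)))"
  shows "wasserstein p Y M \<nu> \<le> (T * D powr p) powr (1 / p)"
proof -
  interpret Y: Metric_space "mspace Y" "mdist Y" by simp
  interpret M: prob_space M by fact
  define m where "m k = measure M {k}" for k
  have spM: "space M = K" using sets_eq_imp_space_eq[of M "count_space K"] M(2) by simp
  have T: "T \<ge> 0" unfolding T_def using a by (intro sum_nonneg) auto
  have m: "m k \<ge> 0" for k by (simp add: m_def)
  have "sum m K = measure M K"
    unfolding m_def using K M by (intro M.finite_measure_eq_sum_singleton[symmetric]) auto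
  then have sm: "sum m K = 1" using M.prob_space spM by simp
  define q where "q z = m (fst z) * ((if fst z = snd z then 1 else 0) + a (snd z)) / (1 + T)" for z
  have q: "q z \<ge> 0" if "z \<in> K \<times> K" for z
    unfolding q_def using that m T a by (intro divide_nonneg_nonneg mult_nonneg_nonneg add_nonneg_nonneg) auto
  have row: "(\<Sum>j\<in>K. q (i, j)) = m i" if "i \<in> K" for i
  proof -
    have "(\<Sum>j\<in>K. q (i, j)) = m i * (\<Sum>j\<in>K. (if i = j then 1 else 0) + a j) / (1 + T)"
      unfolding q_def by (simp add: sum_distrib_left sum_divide_distrib)
    also have "(\<Sum>j\<in>K. (if i = j then 1 else 0) + a j) = 1 + T"
      using that K by (simp add: sum.distrib T_def)
    finally show ?thesis using T by simp
  qed
  have col: "(\<Sum>i\<in>K. q (i, j)) = (m j + a j) / (1 + T)" if "j \<in> K" for j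
  proof -
    have "(\<Sum>i\<in>K. q (i, j)) = (\<Sum>i\<in>K. (if i = j then m i else 0) + m i * a j) / (1 + T)"
      unfolding q_def by (auto simp: sum_divide_distrib algebra_simps intro!: sum.cong)
    also have "(\<Sum>i\<in>K. (if i = j then m i else 0) + m i * a j) = m j + a j"
      using that K by (simp add: sum.distrib sm flip: sum_distrib_right)
    finally show ?thesis .
  qed
  have prod_sum: "(\<Sum>z\<in>A \<times> B. q z) = (\<Sum>i\<in>A. \<Sum>j\<in>B. q (i, j))" for A B
    by (simp add: sum.cartesian_product)
  define \<pi> where "\<pi> = point_measure (K \<times> K) (\<lambda>z. ennreal (q z))"
  have s\<pi>: "sets \<pi> = Pow (K \<times> K)" "space \<pi> = K \<times> K"
    by (auto simp: \<pi>_def sets_point_measure space_point_measure)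
  have s\<nu>: "sets \<nu> = Pow K" "space \<nu> = K"
    by (auto simp: \<nu>_def sets_point_measure space_point_measure)
  have em: "emeasure \<pi> A = ennreal (\<Sum>z\<in>A. q z)" if "A \<subseteq> K \<times> K" for A
    unfolding \<pi>_def using that K q
    by (subst emeasure_point_measure_finite) (auto intro!: sum_ennreal)
  have "\<pi> \<in> couplings M \<nu>"
    unfolding couplings_def
  proof (intro CollectI conjI)
    have "(\<Sum>z\<in>K \<times> K. q z) = 1"
      using row sm by (simp add: prod_sum)
    then show "prob_space \<pi>"
      using em[of "K \<times> K"] s\<pi> by (intro prob_spaceI) simp
    show "sets \<pi> = sets (M \<Otimes>\<^sub>M \<nu>)"
      using sets_pair_countable[OF _ _ M(2) s\<nu>(1)] K s\<pi> by (simp add: countable_finite)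
    show "distr \<pi> M fst = M"
    proof (rule measure_eqI_finite[of _ K])
      fix i assume i: "i \<in> K"
      have f: "fst \<in> measurable \<pi> M" by (auto simp: \<pi>_def spM)
      have "fst -` {i} \<inter> space \<pi> = {i} \<times> K" using i by (auto simp: s\<pi>)
      then have "emeasure (distr \<pi> M fst) {i} = emeasure \<pi> ({i} \<times> K)"
        using f i M(2) by (simp add: emeasure_distr)
      also have "\<dots> = ennreal (\<Sum>j\<in>K. q (i, j))"
        using i by (subst em) (auto simp: prod_sum)
      also have "\<dots> = emeasure M {i}"
        using i by (simp add: row m_def M.emeasure_eq_measure)
      finally show "emeasure (distr \<pi> M fst) {i} = emeasure M {i}" .
    qed (use M K in auto)
    show "distr \<pi> \<nu> snd = \<nu>"
    proof (rule measure_eqI_finite[of _ K])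
      fix j assume j: "j \<in> K"
      have f: "snd \<in> measurable \<pi> \<nu>" by (auto simp: \<pi>_def s\<nu>)
      have "snd -` {j} \<inter> space \<pi> = K \<times> {j}" using j by (auto simp: s\<pi>)
      then have "emeasure (distr \<pi> \<nu> snd) {j} = emeasure \<pi> (K \<times> {j})"
        using f j s\<nu> by (simp add: emeasure_distr)
      also have "\<dots> = ennreal (\<Sum>i\<in>K. q (i, j))"
        using j by (subst em) (auto simp: prod_sum)
      also have "\<dots> = emeasure \<nu> {j}"
        using j K by (simp add: col m_def \<nu>_def emeasure_point_measure_finite)
      finally show "emeasure (distr \<pi> \<nu> snd) {j} = emeasure \<nu> {j}" .
    qed (use s\<nu> K in auto)
  qed
  then have "wasserstein p Y M \<nu> \<le> (\<integral>z. mdist Y (fst z) (snd z) powr p \<partial>\<pi>) powr (1 / p)"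
    unfolding wasserstein_def by (intro cINF_lower bdd_belowI2[where m = 0]) auto
  also have "\<dots> \<le> (T * D powr p) powr (1 / p)"
  proof (rule powr_mono2)
    have "(\<integral>z. mdist Y (fst z) (snd z) powr p \<partial>\<pi>) =
        (\<Sum>z\<in>K \<times> K. q z * mdist Y (fst z) (snd z) powr p)"
      unfolding \<pi>_def using K q by (subst lebesgue_integral_point_measure_finite) auto
    \<comment> \<open>The diagonal has cost zero; off the diagonal the factor 1/(1 + T) is estimated
      by 1 and the distance by \<open>D\<close>.\<close>
    also have "\<dots> \<le> (\<Sum>z\<in>K \<times> K. m (fst z) * a (snd z) * D powr p)"
    proof (rule sum_mono)
      fix z assume z: "z \<in> K \<times> K"
      then obtain i j where ij: "z = (i, j)" "i \<in> K" "j \<in> K" by auto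
      show "q z * mdist Y (fst z) (snd z) powr p \<le> m (fst z) * a (snd z) * D powr p"
      proof (cases "i = j")
        case True
        then show ?thesis using ij K m a by auto
      next
        case False
        have ma: "0 \<le> m i * a j" using m a ij by simp
        have "m i * a j / (1 + T) \<le> m i * a j / 1"
          using ma T by (intro divide_left_mono) auto
        then have "q z \<le> m i * a j" using False ij by (simp add: q_def)
        then show ?thesis
          using D[of i j] ij p ma by (auto intro!: mult_mono powr_mono2)
      qed
    qed
    also have "\<dots> = (\<Sum>i\<in>K. \<Sum>j\<in>K. m i * a j) * D powr p"
      by (simp add: sum.cartesian_product sum_distrib_right case_prod_unfold)
    also have "(\<Sum>i\<in>K. \<Sum>j\<in>K. m i * a j) = T"
      by (simp add: T_def sm flip: sum_product)
    finally show "(\<integral>z. mdist Y (fst z) (snd z) powr p \<partial>\<pi>) \<le> T * D powr p" .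
  qed (use p in auto)
  finally show ?thesis .
qed

section \<open>Approximation by finite spaces\<close>

lemma mtopology_of_finite:
  assumes "finite (mspace Y)"
  shows "mtopology_of Y = discrete_topology (mspace Y)"
proof -
  interpret Y: Metric_space "mspace Y" "mdist Y" by simp
  have "openin Y.mtopology {x}" if "x \<in> mspace Y" for x
  proof -
    have "closedin Y.mtopology (mspace Y - {x})"
      using assms Y.Hausdorff_space_mtopology by (intro closedin_Hausdorff_finite) auto
    then show ?thesis using that by (simp add: closedin_def Diff_Diff_Int)
  qed
  then show ?thesis
    by (metis discrete_topology_unique mtopology_of_def topspace_mtopology_of)
qed

text \<open>Points are moved to a finite net, \<mu> is pushed forward, and the resulting weights are
  perturbed. The positive perturbation provides full support and, being generic, an injective mean
  distance.\<close>

lemma finite_approximation: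
  fixes X :: "real metric"
  assumes X: "mm_space X \<mu>" and p: "p \<ge> 1" and e: "e > 0"
  obtains Y :: "real metric" and \<nu> where "mm_space Y \<nu>" "mm_dist p X \<mu> Y \<nu> < e"
    "finite (mspace Y)" "inj_on (mean_dist Y \<nu>) (mspace Y)"
proof -
  interpret X: Metric_space "mspace X" "mdist X" by simp
  interpret prob_space \<mu> using mm_spaceD(1)[OF X] .
  define \<delta> where "\<delta> = e / 4"
  have \<delta>: "\<delta> > 0" using e by (simp add: \<delta>_def)
  obtain K where K: "finite K" "K \<subseteq> mspace X" "K \<noteq> {}"
    "\<And>x. x \<in> mspace X \<Longrightarrow> \<exists>c\<in>K. mdist X c x < \<delta>"
    using mm_space_finite_net[OF X \<delta>] by metis
  obtain D where D: "D > 0" "\<And>x y. x \<in> mspace X \<Longrightarrow> y \<in> mspace X \<Longrightarrow> mdist X x y \<le> D"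
    using mm_space_diameter[OF X] by metis
  \<comment> \<open>The points are real numbers, so the least admissible net point is a definite
    choice. Its fibres are cut out by finitely many conditions on distances to net points, which
    makes \<open>f\<close> measurable.\<close>
  define f where "f x = Min {c \<in> K. mdist X c x < \<delta>}" for x
  have f: "f x \<in> K" "mdist X (f x) x < \<delta>" if "x \<in> mspace X" for x
  proof -
    have "f x \<in> {c \<in> K. mdist X c x < \<delta>}"
      unfolding f_def using K(1) K(4)[OF that] by (intro Min_in) auto
    then show "f x \<in> K" "mdist X (f x) x < \<delta>" by auto
  qed
  have f_meas: "f -` {k} \<inter> space \<mu> \<in> sets \<mu>" if "k \<in> K" for k
  proof -
    have [measurable]: "mdist X c \<in> borel_measurable \<mu>" if "c \<in> K" for c
      using measurable_mdist_const[OF X] that K(2) by blast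
    have "f x = k \<longleftrightarrow> mdist X k x < \<delta> \<and> (\<forall>c\<in>K. mdist X c x < \<delta> \<longrightarrow> k \<le> c)"
      if "x \<in> mspace X" for x
      unfolding f_def using K(1) K(4)[OF that] \<open>k \<in> K\<close> by (subst Min_eq_iff) auto
    then have "f -` {k} \<inter> space \<mu> =
        {x \<in> space \<mu>. mdist X k x < \<delta> \<and> (\<forall>c\<in>K. mdist X c x < \<delta> \<longrightarrow> k \<le> c)}"
      using mm_spaceD(4)[OF X] by auto
    also have "\<dots> \<in> sets \<mu>"
      using K(1) \<open>k \<in> K\<close> by measurable
    finally show ?thesis .
  qed
  define M where "M = distr \<mu> (count_space K) f"
  have fK: "f \<in> measurable \<mu> (count_space K)"
    using f_meas f K(1) mm_spaceD(4)[OF X] by (auto simp: measurable_count_space_eq2)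
  have M: "prob_space M" "sets M = Pow K"
    unfolding M_def using fK by (auto intro: prob_space_distr)
  have spM: "space M = K" by (simp add: M_def)
  interpret M: prob_space M by fact
  define m where "m k = measure M {k}" for k
  have m: "m k \<ge> 0" for k by (simp add: m_def)
  have "sum m K = measure M K"
    unfolding m_def using K M by (intro M.finite_measure_eq_sum_singleton[symmetric]) auto
  then have sm: "sum m K = 1" using M.prob_space spM by simp
  \<comment> \<open>A total added weight of at most \<open>(\<delta> / D) powr p\<close> keeps the
    transport cost \<open>(T * D powr p) powr (1 / p)\<close> within \<delta>.\<close>
  have \<eta>: "0 < (\<delta> / D) powr p" using D \<delta> by simp
  have sep: "mdist X i i \<noteq> mdist X j i" if "i \<in> K" "j \<in> K" "i \<noteq> j" for i j
    using that K(2) by (auto simp: subset_iff)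
  obtain a where apos: "\<forall>k\<in>K. a k > 0" and a_le: "sum a K \<le> (\<delta> / D) powr p"
      and inj: "inj_on (\<lambda>i. \<Sum>k\<in>K. (m k + a k) * mdist X i k) K"
    by (rule generic_weights[where d = "mdist X" and m = m, OF K(1,3) sep \<eta>])
  note a = apos[rule_format] a_le
  define T where "T = sum a K"
  have T: "T \<ge> 0" unfolding T_def using a by (intro sum_nonneg) (auto simp: less_imp_le)
  define Y where "Y = submetric X K"
  have Y: "mspace Y = K" "mdist Y = mdist X" using K(2) by (auto simp: Y_def)
  define \<nu> where "\<nu> = point_measure K (\<lambda>k. ennreal ((m k + a k) / (1 + T)))"
  have s\<nu>: "sets \<nu> = Pow K" "space \<nu> = K"
    by (auto simp: \<nu>_def sets_point_measure space_point_measure)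
  have pos: "(m k + a k) / (1 + T) > 0" if "k \<in> K" for k
    using m a(1)[OF that] T by (intro divide_pos_pos add_nonneg_pos add_pos_nonneg) auto
  have top: "mtopology_of Y = discrete_topology K"
    using mtopology_of_finite[of Y] Y K(1) by simp
  have mmY: "mm_space Y \<nu>"
    unfolding mm_space_def
  proof (intro conjI allI impI)
    show "compact_space (mtopology_of Y)" using K(1) by (simp add: top compact_space_discrete_topology)
    have "(\<Sum>k\<in>K. (m k + a k) / (1 + T)) = 1"
      using T sm by (simp add: sum.distrib T_def flip: sum_divide_distrib)
    then show "prob_space \<nu>"
      unfolding \<nu>_def using K(1) pos by (intro prob_space_point_measure) (auto simp: less_imp_le sum_ennreal)
    show "sets \<nu> = sets (borel_of (mtopology_of Y))"
    proof -
      have "{U. openin (discrete_topology K) U} = Pow K" by auto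
      moreover have "sigma_sets K (Pow K) = Pow K"
        using sigma_sets_into_sp[of "Pow K" K] by (auto intro: sigma_sets.Basic)
      ultimately show ?thesis by (simp add: top sets_borel_of s\<nu>)
    qed
    fix U assume U: "openin (mtopology_of Y) U \<and> U \<noteq> {}"
    then obtain k where k: "k \<in> U" "U \<subseteq> K" by (auto simp: top)
    have "0 < ennreal ((m k + a k) / (1 + T))" using pos k by auto
    also have "\<dots> = emeasure \<nu> {k}"
      using k K(1) by (simp add: \<nu>_def emeasure_point_measure_finite subset_iff)
    also have "\<dots> \<le> emeasure \<nu> U"
      using k by (intro emeasure_mono) (auto simp: s\<nu>)
    finally show "0 < emeasure \<nu> U" .
  qed
  \<comment> \<open>Normalising the weights only divides all mean distances by 1 + T, so the
    injectivity arranged above persists.\<close>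
  have "mean_dist Y \<nu> i = (\<Sum>k\<in>K. (m k + a k) * mdist X i k) / (1 + T)" for i
    unfolding mean_dist_def \<nu>_def Y using K(1) pos
    by (subst lebesgue_integral_point_measure_finite) (auto simp: less_imp_le sum_divide_distrib)
  then have injY: "inj_on (mean_dist Y \<nu>) (mspace Y)"
    using inj T by (simp add: inj_on_def Y add_nonneg_eq_0_iff)
  have "distr \<mu> \<nu> f = M"
    unfolding M_def by (rule distr_cong) (simp_all add: s\<nu>)
  moreover have "wasserstein p Y M \<nu> \<le> (T * D powr p) powr (1 / p)"
    unfolding \<nu>_def m_def T_def
    by (rule wasserstein_perturbed_le) (use K Y D M a p in \<open>auto simp: less_imp_le subset_iff\<close>)
  moreover have "(T * D powr p) powr (1 / p) \<le> (((\<delta> / D) powr p) * D powr p) powr (1 / p)"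
    using a(2) T p by (intro powr_mono2 mult_right_mono) (auto simp: T_def)
  moreover have "(((\<delta> / D) powr p) * D powr p) powr (1 / p) = \<delta>"
    using D \<delta> p by (simp add: powr_powr flip: powr_mult)
  ultimately have W: "wasserstein p Y (distr \<mu> \<nu> f) \<nu> \<le> 2 * \<delta>" using \<delta> by simp
  have "eps_isometry (2 * \<delta>) X Y f"
    unfolding eps_isometry_def Y
  proof (intro conjI ballI)
    show "f \<in> mspace X \<rightarrow> K" using f by auto
    show "\<exists>x\<in>mspace X. mdist X (f x) y < 2 * \<delta>" if "y \<in> K" for y
      using f(2)[of y] that K(2) \<delta> by (intro bexI[of _ y]) auto
    fix x x' assume x: "x \<in> mspace X" "x' \<in> mspace X"
    have fx: "f x \<in> mspace X" "f x' \<in> mspace X" using f(1) x K(2) by auto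
    have "mdist X (f x) (f x') \<le> mdist X (f x) x + mdist X x x' + mdist X (f x') x'"
      using X.triangle[of "f x" x "f x'"] X.triangle[of x x' "f x'"] X.commute[of x' "f x'"] x fx
      by simp
    moreover have "mdist X x x' \<le> mdist X (f x) x + mdist X (f x) (f x') + mdist X (f x') x'"
      using X.triangle[of x "f x" x'] X.triangle[of "f x" "f x'" x'] X.commute[of x "f x"] x fx
      by simp
    ultimately show "\<bar>mdist X (f x) (f x') - mdist X x x'\<bar> \<le> 2 * \<delta>"
      using f(2)[OF x(1)] f(2)[OF x(2)] by linarith
  qed
  moreover have "f \<in> measurable \<mu> \<nu>"
    unfolding \<nu>_def using K(1) f f_meas mm_spaceD(4)[OF X] by auto
  ultimately have "mm_dist p X \<mu> Y \<nu> \<le> 2 * \<delta>"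
    unfolding mm_dist_def using W \<delta> by (intro cInf_lower bdd_belowI[where m = 0]) auto
  then have "mm_dist p X \<mu> Y \<nu> < e" using e by (simp add: \<delta>_def)
  with that mmY injY Y K(1) show ?thesis by metis
qed

section \<open>A dense countable intersection of open separation conditions\<close>

theorem theorem3p4:
  fixes p :: real
  assumes "p \<ge> 1"
  shows "residual_in (mm_topology p) mm_triv"
proof -
  define G where "G = (\<Inter>n. separated_classes (inverse (real (Suc n))))"
  have Gd: "gdelta_in (mm_topology p) G"
    unfolding G_def using openin_separated_classes[OF assms]
    by (intro gdelta_in_Inter) (auto intro: open_imp_gdelta_in)
  have "G \<subseteq> mm_triv"
  proof
    fix c assume c: "c \<in> G"
    then obtain X \<mu> where X: "c = mm_class X \<mu>" "mm_space X \<mu>"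
      unfolding G_def separated_classes_def by blast
    \<comment> \<open>One fixed representative serves every scale n at once, so its mean distance is
      injective.\<close>
    have sep: "mean_separated (inverse (real (Suc n))) X \<mu>" for n
      using c mm_class_in_separated_classes[OF X(2)] unfolding G_def X(1) by blast
    interpret injective_mean_dist X \<mu>
      by unfold_locales (fact X(2), rule inj_on_mean_dist, fact sep)
    show "c \<in> mm_triv"
      unfolding mm_triv_def using X Coh_full by blast
  qed
  moreover have "mm_topology p closure_of G = topspace (mm_topology p)"
  proof (rule antisym[OF closure_of_subset_topspace], rule subsetI)
    fix c assume c: "c \<in> topspace (mm_topology p)"
    then obtain X \<mu> where X: "c = mm_class X \<mu>" "mm_space X \<mu>"
      unfolding topspace_mm_topology mm_classes_def by blast
    have "\<exists>y. y \<in> G \<and> y \<in> V" if V: "c \<in> V" "openin (mm_topology p) V" for V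
    proof -
      obtain \<epsilon> where "\<epsilon> > 0" and
        \<epsilon>: "\<And>Y \<nu>. mm_space Y \<nu> \<Longrightarrow> mm_dist p X \<mu> Y \<nu> < \<epsilon> \<Longrightarrow> mm_class Y \<nu> \<in> V"
        using V X unfolding openin_mm_topology mm_open_def by blast
      obtain Y :: "real metric" and \<nu> where Y: "mm_space Y \<nu>" "mm_dist p X \<mu> Y \<nu> < \<epsilon>"
          "finite (mspace Y)" "inj_on (mean_dist Y \<nu>) (mspace Y)"
        using finite_approximation[OF X(2) assms \<open>\<epsilon> > 0\<close>] by metis
      \<comment> \<open>On a finite space injectivity of the mean distance already gives separation
        at every scale.\<close>
      have "mm_class Y \<nu> \<in> G"
        unfolding G_def using Y(3,4)
        by (auto simp: mm_class_in_separated_classes[OF Y(1)] intro!: mean_separated_finite)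
      then show ?thesis using \<epsilon> Y by blast
    qed
    with c show "c \<in> mm_topology p closure_of G" by (simp add: in_closure_of)
  qed
  moreover have "G \<subseteq> topspace (mm_topology p)" using Gd by (rule gdelta_in_subset)
  moreover have "mm_triv \<subseteq> topspace (mm_topology p)"
    unfolding topspace_mm_topology mm_triv_def mm_classes_def by blast
  ultimately show ?thesis
    unfolding residual_in_def using Gd by blast
qed

end
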